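(* Let $k$ be a positive integer that is not a perfect square, and let $c \in (0,1)$ be a constant sufficiently close to $1$ (in terms of $k$). There exist constants $C_1, C_2 > 0$ and $N_0$, depending only on $k$ and $c$, such that for all $N \ge N_0$ and all real $M$ with $1 \le M \le N$ the following holds. Let $A_N = \{ x_1 + x_2\sqrt{k} : x_1, x_2 \in \mathbb{Z} \cap [-\sqrt{N}, \sqrt{N}] \}$ and let $X = S$, where $S$ is the set of all real numbers $$ \frac{p_1 + p_2\sqrt{k}}{q_1 + q_2\sqrt{k}} $$ with $p_1, p_2, q_1, q_2 \in \mathbb{Z}$ satisfying $|p_i|, |q_i| \in [c\sqrt{M}, \sqrt{M}]$ for $i = 1,2$, $\gcd(p_1^2 - k p_2^2,\, q_1^2 - k q_2^2) \le 5$ and $\gcd(p_1, p_2) \le 5$. Then $|X| \le |A_N|^2$ and $$ C_1 |A_N|^3 |X|^{1/2} \le \sum_{x \in X} E^+(A_N, xA_N) \le C_2 |A_N|^3 |X|^{1/2}. $$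
   Context: For finite sets $A, B \subset \mathbb{R}$, the additive energy is $E^+(A,B) = |\{ (a,a',b,b') \in A^2 \times B^2 : a + b = a' + b' \}|$. For $x \in \mathbb{R}$, $xA = \{ xa : a \in A \}$. $|\cdot|$ denotes cardinality when applied to a set. *)

theory Defs
  imports Complex_Main
begin

definition additive_energy :: "real set \<Rightarrow> real set \<Rightarrow> nat" where
  "additive_energy A B =
     card {(a, a', b, b'). a \<in> A \<and> a' \<in> A \<and> b \<in> B \<and> b' \<in> B \<and> a + b = a' + b'}"

definition dilate :: "real \<Rightarrow> real set \<Rightarrow> real set" where
  "dilate x A = (\<lambda>a. x * a) ` A"

definition A_set :: "nat \<Rightarrow> real \<Rightarrow> real set" where
  "A_set k N = {of_int x1 + of_int x2 * sqrt (real k) | x1 x2 :: int.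
      of_int x1 \<in> {- sqrt N .. sqrt N} \<and> of_int x2 \<in> {- sqrt N .. sqrt N}}"

(* For 0 < c, 1 \<le> M and k not a perfect square, all four of p1, p2, q1, q2 are nonzero,
   so the denominator never vanishes. *)
definition S_set :: "nat \<Rightarrow> real \<Rightarrow> real \<Rightarrow> real set" where
  "S_set k c M =
     {(of_int p1 + of_int p2 * sqrt (real k)) / (of_int q1 + of_int q2 * sqrt (real k))
        | p1 p2 q1 q2 :: int.
          \<bar>of_int p1\<bar> \<in> {c * sqrt M .. sqrt M} \<and> \<bar>of_int p2\<bar> \<in> {c * sqrt M .. sqrt M} \<and>
          \<bar>of_int q1\<bar> \<in> {c * sqrt M .. sqrt M} \<and> \<bar>of_int q2\<bar> \<in> {c * sqrt M .. sqrt M} \<and>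
          gcd (p1\<^sup>2 - int k * p2\<^sup>2) (q1\<^sup>2 - int k * q2\<^sup>2) \<le> 5 \<and>
          gcd p1 p2 \<le> 5}"

end

theory Submission
  imports Defs "HOL-Computational_Algebra.Primes" "HOL-Library.Product_Plus"
begin

text \<open>
  Write \<open>x = \<alpha> / \<beta>\<close> with \<open>\<alpha>, \<beta>\<close> in \<open>\<int>[\<surd>k]\<close> and coordinates of size about \<open>\<surd>M\<close>. The energy
  \<open>E(A, x A)\<close> counts solutions of \<open>\<beta> (a - a') = \<alpha> (b' - b)\<close> in \<open>A\<close>. Every small \<open>t\<close> in \<open>\<int>[\<surd>k]\<close>
  gives the solutions \<open>a - a' = \<alpha> t\<close>, \<open>b' - b = \<beta> t\<close>, and there is room for about \<open>N / M\<close> such \<open>t\<close>;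
  this is the lower bound \<open>E(A, x A) \<gg> N\<^sup>3 / M\<close> (\<open>energy_lower_bound\<close>). Conversely, a Bezout
  identity for the norms of \<open>\<alpha>\<close> and \<open>\<beta>\<close> shows that all solutions have this form up to the factor
  \<open>gcd(N \<alpha>, N \<beta>) \<le> 5\<close>, and \<open>\<bar>N \<beta>\<bar> \<gg> M\<close> because \<open>c\<close> is close to \<open>1\<close>; hence only \<open>O(N / M)\<close> many
  \<open>t\<close> occur and \<open>E(A, x A) \<ll> N\<^sup>3 / M\<close> (\<open>energy_upper_bound\<close>).

  As \<open>|A|\<close> is of order \<open>N\<close>, what remains is that \<open>|X|\<close> is of order \<open>M\<^sup>2\<close>. The upper bound counts
  coordinates. The lower bound (\<open>card_S_set_ge\<close>) needs two things. A positive proportion of the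
  quadruples \<open>(p\<^sub>1, p\<^sub>2, q\<^sub>1, q\<^sub>2)\<close> has coprime norms and coprime \<open>p\<^sub>1, p\<^sub>2\<close>: in the progression
  \<open>(p\<^sub>1, p\<^sub>2) \<equiv> (1, 0)\<close> modulo a multiple \<open>Q\<close> of all small primes no small prime divides a norm, and
  by a union bound the remaining primes exclude only a small proportion (\<open>sieve_lower_bound\<close>). And
  different positive quadruples with coprime norms give different quotients: by the same Bezout
  identity two equal quotients differ by a factor \<open>t\<close> in \<open>\<int>[\<surd>k]\<close>, and for \<open>c\<close> close to \<open>1\<close> both
  conjugates of \<open>t\<close> are so close to \<open>1\<close> that \<open>t = 1\<close> (\<open>quotient_determines_pair\<close>). When \<open>M\<close> is
  bounded and \<open>X\<close> is nonempty, \<open>|X| \<ge> 1\<close> suffices.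
\<close>

section \<open>Arithmetic in the quadratic ring\<close>

text \<open>
  Elements of \<open>\<int>[\<surd>k]\<close> are handled through their integer coordinates, so that sums are the
  componentwise sums of pairs.
\<close>
definition quad :: "nat \<Rightarrow> int \<times> int \<Rightarrow> real" where
  "quad k z = of_int (fst z) + of_int (snd z) * sqrt (real k)"

definition qmult :: "nat \<Rightarrow> int \<times> int \<Rightarrow> int \<times> int \<Rightarrow> int \<times> int" where
  "qmult k z w = (fst z * fst w + int k * snd z * snd w, fst z * snd w + snd z * fst w)"

definition qnorm :: "nat \<Rightarrow> int \<times> int \<Rightarrow> int" where
  "qnorm k z = (fst z)\<^sup>2 - int k * (snd z)\<^sup>2"

definition square :: "int \<Rightarrow> (int \<times> int) set" where
  "square m = {-m..m} \<times> {-m..m}"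

lemma quad_add: "quad k (z + w) = quad k z + quad k w"
  by (simp add: quad_def algebra_simps)

lemma quad_diff: "quad k (z - w) = quad k z - quad k w"
  by (simp add: quad_def algebra_simps)

lemma quad_mult: "quad k (qmult k z w) = quad k z * quad k w"
proof -
  have "a * c + K * b * d + (a * d + b * c) * s = (a + b * s) * (c + d * s)"
    if "s * s = K" for a b c d s K :: real
    unfolding that[symmetric] by (simp add: algebra_simps)
  from this[of "sqrt (real k)" "real k"] show ?thesis
    by (simp add: quad_def qmult_def)
qed

lemma finite_square [simp]: "finite (square m)"
  by (simp add: square_def)

lemma card_square: "m \<ge> 0 \<Longrightarrow> real (card (square m)) = (2 * of_int m + 1)\<^sup>2"
  by (simp add: square_def card_cartesian_product power2_eq_square)

lemma mem_square: "z \<in> square m \<longleftrightarrow> \<bar>fst z\<bar> \<le> m \<and> \<bar>snd z\<bar> \<le> m"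
  by (cases z) (auto simp: square_def)

lemma qnorm_eq_0_iff:
  assumes "\<nexists>m::nat. k = m\<^sup>2"
  shows "qnorm k z = 0 \<longleftrightarrow> z = 0"
proof
  assume "qnorm k z = 0"
  then have eq: "(fst z)\<^sup>2 = int k * (snd z)\<^sup>2" by (simp add: qnorm_def)
  have "snd z = 0"
  proof (rule ccontr)
    assume nz: "snd z \<noteq> 0"
    have "(snd z)\<^sup>2 dvd (fst z)\<^sup>2" by (simp add: eq)
    then have "snd z dvd fst z" by (simp add: pow_divides_pow_iff)
    then obtain m where m: "fst z = snd z * m" by (elim dvdE)
    have "(snd z)\<^sup>2 * m\<^sup>2 = (snd z)\<^sup>2 * int k"
      using eq by (simp add: m power_mult_distrib mult.commute)
    then have "int k = m\<^sup>2" using nz by simp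
    then have "int k = int ((nat \<bar>m\<bar>)\<^sup>2)" by simp
    then have "k = (nat \<bar>m\<bar>)\<^sup>2" by (simp only: of_nat_eq_iff)
    then show False using assms by blast
  qed
  then show "z = 0" using eq by (simp add: prod_eq_iff)
qed (simp add: qnorm_def)

lemma quad_eq_0_iff:
  assumes "\<nexists>m::nat. k = m\<^sup>2"
  shows "quad k z = 0 \<longleftrightarrow> z = 0"
proof
  assume "quad k z = 0"
  then have "of_int (fst z) = - (of_int (snd z) * sqrt (real k))" by (simp add: quad_def)
  then have "(of_int (fst z))\<^sup>2 = (of_int (snd z) * sqrt (real k))\<^sup>2" by simp
  then have "real_of_int ((fst z)\<^sup>2) = real_of_int (int k * (snd z)\<^sup>2)"
    by (simp add: power_mult_distrib)
  then have "qnorm k z = 0" unfolding of_int_eq_iff by (simp add: qnorm_def)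
  then show "z = 0" using qnorm_eq_0_iff[OF assms] by blast
qed (simp add: quad_def)

lemma quad_eq_iff:
  assumes "\<nexists>m::nat. k = m\<^sup>2"
  shows "quad k z = quad k w \<longleftrightarrow> z = w"
  using quad_eq_0_iff[OF assms, of "z - w"] by (simp add: quad_diff)

text \<open>
  With \<open>X N(p) + Y N(q) = g\<close> the element \<open>t = X p' d + Y q' e\<close>, where the primes denote
  conjugates, satisfies \<open>q t = X p' p e + Y q' q e = g e\<close>. So \<open>t\<close> plays the role of \<open>g e / q\<close> and
  \<open>g d / p\<close>: up to \<open>g\<close>, equal quotients \<open>d / e = p / q\<close> come from a common multiplier.
\<close>
lemma qmult_gcd_quotient:
  fixes p q d e :: "int \<times> int"
  assumes "qmult k q d = qmult k p e"
  defines "g \<equiv> gcd (qnorm k p) (qnorm k q)"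
  obtains t where "qmult k q t = (g * fst e, g * snd e)" "qmult k p t = (g * fst d, g * snd d)"
proof -
  obtain p1 p2 q1 q2 d1 d2 e1 e2 where
    pq: "p = (p1, p2)" "q = (q1, q2)" "d = (d1, d2)" "e = (e1, e2)" by fastforce
  obtain X Y where XY: "X * (p1\<^sup>2 - int k * p2\<^sup>2) + Y * (q1\<^sup>2 - int k * q2\<^sup>2) = g"
    using bezout_int[of "qnorm k p" "qnorm k q"] by (auto simp: pq g_def qnorm_def)
  have E: "q1 * d1 + int k * q2 * d2 = p1 * e1 + int k * p2 * e2"
    "q1 * d2 + q2 * d1 = p1 * e2 + p2 * e1"
    using assms(1) by (auto simp: pq qmult_def)
  define t1 where "t1 = X * (p1 * d1 - int k * p2 * d2) + Y * (q1 * e1 - int k * q2 * e2)"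
  define t2 where "t2 = X * (p1 * d2 - p2 * d1) + Y * (q1 * e2 - q2 * e1)"
  show ?thesis
  proof (rule that[of "(t1, t2)"])
    have "q1 * t1 + int k * q2 * t2 = g * e1" "q1 * t2 + q2 * t1 = g * e2"
      "p1 * t1 + int k * p2 * t2 = g * d1" "p1 * t2 + p2 * t1 = g * d2"
      unfolding t1_def t2_def XY[symmetric] using E by algebra+
    then show "qmult k q (t1, t2) = (g * fst e, g * snd e)"
      "qmult k p (t1, t2) = (g * fst d, g * snd d)"
      by (simp_all add: pq qmult_def)
  qed
qed

section \<open>The energy of a single dilate\<close>

lemma A_set_eq:
  assumes "N \<ge> 0"
  shows "A_set k N = quad k ` square \<lfloor>sqrt N\<rfloor>"
proof -
  have "of_int x \<in> {- sqrt N..sqrt N} \<longleftrightarrow> x \<in> {-\<lfloor>sqrt N\<rfloor>..\<lfloor>sqrt N\<rfloor>}" for x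
    by (simp add: le_floor_iff minus_le_iff)
  then show ?thesis
    by (force simp: A_set_def quad_def square_def image_def)
qed

lemma card_A_set:
  assumes "\<nexists>m::nat. k = m\<^sup>2" "N \<ge> 0"
  shows "real (card (A_set k N)) = (2 * of_int \<lfloor>sqrt N\<rfloor> + 1)\<^sup>2"
proof -
  have "inj_on (quad k) (square \<lfloor>sqrt N\<rfloor>)"
    using quad_eq_iff[OF assms(1)] by (auto intro: inj_onI)
  then show ?thesis
    using assms by (simp add: A_set_eq card_image card_square)
qed

lemma card_A_set_bounds:
  assumes "\<nexists>m::nat. k = m\<^sup>2" "N \<ge> 1"
  shows "N \<le> real (card (A_set k N))" "real (card (A_set k N)) \<le> 9 * N"
proof -
  have s: "1 \<le> sqrt N" using assms by simp
  have f: "of_int \<lfloor>sqrt N\<rfloor> \<le> sqrt N" "sqrt N \<le> of_int \<lfloor>sqrt N\<rfloor> + 1" by linarith+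
  have "0 \<le> \<lfloor>sqrt N\<rfloor>" using s by simp
  then have f0: "0 \<le> real_of_int \<lfloor>sqrt N\<rfloor>" by simp
  have "(sqrt N)\<^sup>2 \<le> (2 * of_int \<lfloor>sqrt N\<rfloor> + 1)\<^sup>2"
    using s f f0 by (intro power_mono) linarith+
  then show "N \<le> real (card (A_set k N))" using assms by (simp add: card_A_set)
  have "(2 * of_int \<lfloor>sqrt N\<rfloor> + 1)\<^sup>2 \<le> (3 * sqrt N)\<^sup>2"
    using s f f0 by (intro power_mono) linarith+
  then show "real (card (A_set k N)) \<le> 9 * N" using assms by (simp add: card_A_set power_mult_distrib)
qed

lemma additive_energy_dilate:
  assumes "x \<noteq> 0"
  shows "additive_energy A (dilate x A) =
    card {(a, a', b, b'). a \<in> A \<and> a' \<in> A \<and> b \<in> A \<and> b' \<in> A \<and> a + x * b = a' + x * b'}"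
    (is "_ = card ?E")
proof -
  have "{(a, a', b, b'). a \<in> A \<and> a' \<in> A \<and> b \<in> dilate x A \<and> b' \<in> dilate x A \<and> a + b = a' + b'}
      = (\<lambda>(a, a', b, b'). (a, a', x * b, x * b')) ` ?E"
    by (force simp: dilate_def image_iff)
  moreover have "inj_on (\<lambda>(a, a', b, b'). (a, a', x * b, x * b')) ?E"
    using assms by (auto intro!: inj_onI)
  ultimately show ?thesis by (simp add: additive_energy_def card_image)
qed

lemma abs_norm_form_le:
  fixes x y u v :: int
  assumes "\<bar>real_of_int x\<bar> \<le> S" "\<bar>real_of_int y\<bar> \<le> S" "\<bar>real_of_int u\<bar> \<le> T" "\<bar>real_of_int v\<bar> \<le> T"
  shows "\<bar>real_of_int (x * u)\<bar> + \<bar>real_of_int (int k * y * v)\<bar> \<le> (1 + real k) * S * T"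
proof -
  have "S \<ge> 0" "T \<ge> 0" using assms by linarith+
  then have "\<bar>real_of_int x\<bar> * \<bar>real_of_int u\<bar> \<le> S * T" "\<bar>real_of_int y\<bar> * \<bar>real_of_int v\<bar> \<le> S * T"
    using assms by (auto intro: mult_mono)
  then have "\<bar>real_of_int x\<bar> * \<bar>real_of_int u\<bar> + real k * (\<bar>real_of_int y\<bar> * \<bar>real_of_int v\<bar>) \<le> S * T + real k * (S * T)"
    by (intro add_mono mult_left_mono) auto
  then show ?thesis by (simp add: abs_mult algebra_simps)
qed

text \<open>
  The multiplier \<open>t\<close> with \<open>q t = g e\<close> determines \<open>e\<close>. Multiplying by the conjugate of \<open>q\<close> gives
  \<open>N(q) t = g q' e\<close>, whose right side has coordinates of size \<open>O(\<surd>N \<surd>M)\<close>; division by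
  \<open>\<bar>N(q)\<bar> \<ge> \<delta> M\<close> leaves \<open>O(N / M)\<close> possible \<open>t\<close>.
\<close>
lemma card_proportional_pairs_le:
  fixes p q :: "int \<times> int" and N M \<delta> :: real
  assumes k: "\<nexists>m::nat. k = m\<^sup>2" and MN: "1 \<le> M" "M \<le> N" and "\<delta> > 0"
    and q: "\<bar>real_of_int (fst q)\<bar> \<le> sqrt M" "\<bar>real_of_int (snd q)\<bar> \<le> sqrt M"
    and norm: "\<delta> * M \<le> \<bar>real_of_int (qnorm k q)\<bar>"
    and g: "gcd (qnorm k p) (qnorm k q) \<le> 5"
  defines "E \<equiv> {e \<in> square (2 * \<lfloor>sqrt N\<rfloor>). \<exists>d. qmult k q d = qmult k p e}"
  shows "real (card E) \<le> (20 * (1 + real k) / \<delta> + 1)\<^sup>2 * (N / M)"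
proof -
  define g where "g = gcd (qnorm k p) (qnorm k q)"
  define B where "B = 10 * (1 + real k) / \<delta> * sqrt (N / M)"
  have "qnorm k q \<noteq> 0" using norm \<open>\<delta> > 0\<close> MN by (auto simp: mult_le_0_iff)
  then have g0: "0 < g" and g5: "g \<le> 5" using g by (auto simp: g_def)
  have q0: "quad k q \<noteq> 0"
    using \<open>qnorm k q \<noteq> 0\<close> quad_eq_0_iff[OF k, of q] qnorm_eq_0_iff[OF k, of q] by blast
  have B0: "B \<ge> 0" using \<open>\<delta> > 0\<close> MN by (simp add: B_def)
  have "\<exists>t \<in> square \<lfloor>B\<rfloor>. qmult k q t = (g * fst e, g * snd e)" if eE: "e \<in> E" for e
  proof -
    obtain d where d: "qmult k q d = qmult k p e" using eE unfolding E_def by blast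
    obtain t where t: "qmult k q t = (g * fst e, g * snd e)"
      using qmult_gcd_quotient[OF d] unfolding g_def by blast
    have e: "\<bar>real_of_int (fst e)\<bar> \<le> 2 * sqrt N" "\<bar>real_of_int (snd e)\<bar> \<le> 2 * sqrt N"
      using eE by (auto simp: E_def mem_square) linarith+
    have t': "fst q * fst t + int k * snd q * snd t = g * fst e" "fst q * snd t + snd q * fst t = g * snd e"
      using t by (auto simp: qmult_def)
    have t1: "qnorm k q * fst t = g * (fst e * fst q - int k * snd e * snd q)"
      unfolding qnorm_def using t' by algebra
    have t2: "qnorm k q * snd t = g * (snd e * fst q - fst e * snd q)"
      unfolding qnorm_def using t' by algebra
    have bound: "\<bar>x\<bar> \<le> \<lfloor>B\<rfloor>" if eq: "qnorm k q * x = g * y"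
      and y: "\<bar>real_of_int y\<bar> \<le> (1 + real k) * (2 * sqrt N) * sqrt M" for x y
    proof -
      have "\<delta> * M * \<bar>real_of_int x\<bar> \<le> \<bar>real_of_int (qnorm k q)\<bar> * \<bar>real_of_int x\<bar>"
        using norm by (intro mult_right_mono) auto
      also have "\<dots> = of_int g * \<bar>real_of_int y\<bar>"
        using arg_cong[OF eq, of "\<lambda>z. \<bar>real_of_int z\<bar>"] g0 by (simp add: abs_mult)
      also have "\<dots> \<le> 5 * ((1 + real k) * (2 * sqrt N) * sqrt M)"
        using y g0 g5 by (intro mult_mono) auto
      also have "\<dots> = 10 * (1 + real k) * sqrt N * (M / sqrt M)"
        using MN by (simp add: real_div_sqrt)
      also have "\<dots> = \<delta> * M * B"
        using \<open>\<delta> > 0\<close> by (simp add: B_def real_sqrt_divide)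
      finally have "\<bar>real_of_int x\<bar> \<le> B"
        using \<open>\<delta> > 0\<close> MN by simp
      then show ?thesis by linarith
    qed
    have "\<bar>real_of_int (fst e * fst q - int k * snd e * snd q)\<bar> \<le> (1 + real k) * (2 * sqrt N) * sqrt M"
      using abs_norm_form_le[OF e q, of k] by linarith
    moreover have "\<bar>real_of_int (snd e * fst q - fst e * snd q)\<bar> \<le> (1 + real k) * (2 * sqrt N) * sqrt M"
    proof -
      have "\<bar>real_of_int (snd e * fst q)\<bar> + \<bar>real_of_int (int 1 * fst e * snd q)\<bar> \<le> (1 + real 1) * (2 * sqrt N) * sqrt M"
        by (rule abs_norm_form_le[OF e(2,1) q])
      also have "\<dots> \<le> (1 + real k) * (2 * sqrt N) * sqrt M"
      proof -
        have "k \<noteq> 0" using k zero_power2 by (metis)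
        then show ?thesis using MN by (intro mult_right_mono) auto
      qed
      finally show ?thesis by simp
    qed
    ultimately have "t \<in> square \<lfloor>B\<rfloor>"
      using bound[OF t1] bound[OF t2] by (simp add: mem_square)
    then show ?thesis using t by blast
  qed
  then obtain t where t: "\<And>e. e \<in> E \<Longrightarrow> t e \<in> square \<lfloor>B\<rfloor> \<and> qmult k q (t e) = (g * fst e, g * snd e)"
    by metis
  have "inj_on t E"
  proof (rule inj_onI)
    fix e e' assume "e \<in> E" "e' \<in> E" "t e = t e'"
    then have "(g * fst e, g * snd e) = (g * fst e', g * snd e')"
      using t by metis
    then show "e = e'" using g0 by (simp add: prod_eq_iff)
  qed
  then have "card E \<le> card (square \<lfloor>B\<rfloor>)"
    using t by (intro card_inj_on_le[of t]) auto
  then have "real (card E) \<le> (2 * of_int \<lfloor>B\<rfloor> + 1)\<^sup>2"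
    using B0 by (simp flip: card_square)
  also have "\<dots> \<le> (2 * B + sqrt (N / M))\<^sup>2"
  proof (rule power_mono)
    have "1 \<le> sqrt (N / M)" using MN by simp
    then show "2 * of_int \<lfloor>B\<rfloor> + 1 \<le> 2 * B + sqrt (N / M)" by linarith
    have "0 \<le> \<lfloor>B\<rfloor>" using B0 by simp
    then show "0 \<le> 2 * real_of_int \<lfloor>B\<rfloor> + 1" by simp
  qed
  also have "2 * B + sqrt (N / M) = (20 * (1 + real k) / \<delta> + 1) * sqrt (N / M)"
    by (simp add: B_def algebra_simps)
  also have "\<dots>\<^sup>2 = (20 * (1 + real k) / \<delta> + 1)\<^sup>2 * (N / M)"
    using MN by (simp add: power_mult_distrib)
  finally show ?thesis .
qed

text \<open>
  A solution of \<open>a + x b = a' + x b'\<close> is determined by \<open>a'\<close>, \<open>b\<close> and the difference \<open>b' - b\<close>, and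
  the possible differences are those counted in \<open>card_proportional_pairs_le\<close>.
\<close>
lemma energy_upper_bound:
  fixes p q :: "int \<times> int" and N M \<delta> :: real
  assumes k: "\<nexists>m::nat. k = m\<^sup>2" and MN: "1 \<le> M" "M \<le> N" and "\<delta> > 0" and p: "p \<noteq> 0"
    and q: "\<bar>real_of_int (fst q)\<bar> \<le> sqrt M" "\<bar>real_of_int (snd q)\<bar> \<le> sqrt M"
    and norm: "\<delta> * M \<le> \<bar>real_of_int (qnorm k q)\<bar>"
    and g: "gcd (qnorm k p) (qnorm k q) \<le> 5"
  shows "real (additive_energy (A_set k N) (dilate (quad k p / quad k q) (A_set k N)))
    \<le> 81 * (20 * (1 + real k) / \<delta> + 1)\<^sup>2 * (N ^ 3 / M)"
proof -
  define x where "x = quad k p / quad k q"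
  define E where "E = {e \<in> square (2 * \<lfloor>sqrt N\<rfloor>). \<exists>d. qmult k q d = qmult k p e}"
  let ?A = "A_set k N"
  let ?F = "{(a, a', b, b'). a \<in> ?A \<and> a' \<in> ?A \<and> b \<in> ?A \<and> b' \<in> ?A \<and> a + x * b = a' + x * b'}"
  have q0: "quad k q \<noteq> 0" using norm \<open>\<delta> > 0\<close> MN
    by (auto simp: quad_eq_0_iff[OF k] qnorm_def mult_le_0_iff)
  have x0: "x \<noteq> 0" using p q0 by (simp add: x_def quad_eq_0_iff[OF k])
  have A: "?A = quad k ` square \<lfloor>sqrt N\<rfloor>" using MN by (simp add: A_set_eq)
  have finA: "finite ?A" by (simp add: A)
  have finE: "finite E" by (simp add: E_def)
  have "inj_on (\<lambda>(a, a', b, b'). (a', b, b' - b)) ?F"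
    by (rule inj_onI) auto
  moreover have "(\<lambda>(a, a', b, b'). (a', b, b' - b)) ` ?F \<subseteq> ?A \<times> ?A \<times> quad k ` E"
  proof safe
    fix a a' b b' assume mem: "a \<in> ?A" "a' \<in> ?A" "b \<in> ?A" "b' \<in> ?A" and eq: "a + x * b = a' + x * b'"
    obtain u u' v v' where uv: "a = quad k u" "a' = quad k u'" "b = quad k v" "b' = quad k v'"
      "u \<in> square \<lfloor>sqrt N\<rfloor>" "u' \<in> square \<lfloor>sqrt N\<rfloor>" "v \<in> square \<lfloor>sqrt N\<rfloor>" "v' \<in> square \<lfloor>sqrt N\<rfloor>"
      using mem unfolding A by blast
    have "quad k (u - u') = x * quad k (v' - v)"
      using eq by (simp add: uv quad_diff algebra_simps)
    then have "quad k (qmult k q (u - u')) = quad k (qmult k p (v' - v))"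
      using q0 by (simp add: x_def quad_mult field_simps)
    then have "qmult k q (u - u') = qmult k p (v' - v)" by (simp add: quad_eq_iff[OF k])
    moreover have "v' - v \<in> square (2 * \<lfloor>sqrt N\<rfloor>)"
      using uv(7,8) by (auto simp: mem_square)
    ultimately have "v' - v \<in> E" unfolding E_def by blast
    then show "b' - b \<in> quad k ` E" by (auto simp: uv simp flip: quad_diff)
  qed
  ultimately have "card ?F \<le> card (?A \<times> ?A \<times> quad k ` E)"
    by (rule card_inj_on_le) (use finA finE in auto)
  also have "\<dots> \<le> (card ?A)\<^sup>2 * card E"
    using finE by (simp add: card_cartesian_product power2_eq_square card_image_le)
  finally have "real (card ?F) \<le> (real (card ?A))\<^sup>2 * real (card E)"
    by (simp flip: of_nat_power of_nat_mult)
  also have "\<dots> \<le> (9 * N)\<^sup>2 * ((20 * (1 + real k) / \<delta> + 1)\<^sup>2 * (N / M))"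
  proof (intro mult_mono power_mono)
    show "real (card ?A) \<le> 9 * N" using MN by (intro card_A_set_bounds[OF k]) simp
    show "real (card E) \<le> (20 * (1 + real k) / \<delta> + 1)\<^sup>2 * (N / M)"
      unfolding E_def by (rule card_proportional_pairs_le) (use assms in auto)
  qed auto
  also have "\<dots> = 81 * (20 * (1 + real k) / \<delta> + 1)\<^sup>2 * (N ^ 3 / M)"
    by (simp add: power2_eq_square power3_eq_cube)
  finally show ?thesis
    using x0 by (simp add: additive_energy_dilate flip: x_def)
qed

text \<open>
  Take \<open>a', b\<close> from the square of half the size and \<open>t\<close> of size at most a small multiple of
  \<open>\<surd>(N / M)\<close>; then \<open>a = a' + p t\<close> and \<open>b' = b + q t\<close> still lie in \<open>A\<close>.
\<close>
lemma energy_lower_bound: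
  fixes p q :: "int \<times> int" and N M :: real
  assumes k: "\<nexists>m::nat. k = m\<^sup>2" and MN: "1 \<le> M" "M \<le> N" and pq: "p \<noteq> 0" "q \<noteq> 0"
    and p: "\<bar>real_of_int (fst p)\<bar> \<le> sqrt M" "\<bar>real_of_int (snd p)\<bar> \<le> sqrt M"
    and q: "\<bar>real_of_int (fst q)\<bar> \<le> sqrt M" "\<bar>real_of_int (snd q)\<bar> \<le> sqrt M"
  shows "N ^ 3 / M / (256 * (1 + real k)\<^sup>2)
    \<le> real (additive_energy (A_set k N) (dilate (quad k p / quad k q) (A_set k N)))"
proof -
  define x where "x = quad k p / quad k q"
  let ?A = "A_set k N"
  let ?F = "{(a, a', b, b'). a \<in> ?A \<and> a' \<in> ?A \<and> b \<in> ?A \<and> b' \<in> ?A \<and> a + x * b = a' + x * b'}"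
  define r where "r = \<lfloor>sqrt N\<rfloor>"
  define h where "h = r div 2"
  define B where "B = sqrt (N / M) / (4 * (1 + real k))"
  define K where "K = 1 + real k"
  have "K > 0" by (simp add: K_def)
  define m where "m = \<lfloor>B\<rfloor>"
  have q0: "quad k q \<noteq> 0" and p0: "quad k p \<noteq> 0" using pq by (simp_all add: quad_eq_0_iff[OF k])
  have x0: "x \<noteq> 0" using p0 q0 by (simp add: x_def)
  have A: "?A = quad k ` square r" using MN by (simp add: A_set_eq r_def)
  have "1 \<le> sqrt N" using MN by simp
  have "0 \<le> B" using MN by (simp add: B_def)
  then have m0: "0 \<le> m" by (simp add: m_def)
  have r1: "1 \<le> r" using \<open>1 \<le> sqrt N\<close> by (simp add: r_def)
  then have h0: "0 \<le> h" by (simp add: h_def)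
  have rN: "sqrt N < of_int r + 1" by (simp add: r_def)
  have shift: "v + qmult k w t \<in> square r"
    if w: "\<bar>real_of_int (fst w)\<bar> \<le> sqrt M" "\<bar>real_of_int (snd w)\<bar> \<le> sqrt M"
      and t: "t \<in> square m" and v: "v \<in> square h" for v w t
  proof -
    have t': "\<bar>real_of_int (fst t)\<bar> \<le> B" "\<bar>real_of_int (snd t)\<bar> \<le> B"
      using t by (auto simp: mem_square m_def) linarith+
    have "(1 + real k) * sqrt M * B = sqrt N / 4"
      using MN \<open>K > 0\<close> by (simp add: B_def real_sqrt_divide flip: K_def)
    moreover have "\<bar>real_of_int (fst (qmult k w t))\<bar> \<le> (1 + real k) * sqrt M * B"
      using abs_norm_form_le[OF w t', of k] by (simp add: qmult_def)
    moreover have "\<bar>real_of_int (snd (qmult k w t))\<bar> \<le> (1 + real k) * sqrt M * B"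
    proof -
      have "\<bar>real_of_int (fst w * snd t)\<bar> + \<bar>real_of_int (int 1 * snd w * fst t)\<bar> \<le> (1 + real 1) * sqrt M * B"
        by (rule abs_norm_form_le[OF w t'(2,1)])
      also have "\<dots> \<le> (1 + real k) * sqrt M * B"
      proof -
        have "k \<noteq> 0" using k zero_power2 by (metis)
        then show ?thesis using MN \<open>0 \<le> B\<close> by (intro mult_right_mono) auto
      qed
      finally show ?thesis by (simp add: qmult_def)
    qed
    moreover have "\<bar>fst v\<bar> \<le> h" "\<bar>snd v\<bar> \<le> h" using v by (auto simp: mem_square)
    moreover have "2 * h \<le> r" by (simp add: h_def)
    ultimately have "\<bar>fst v + fst (qmult k w t)\<bar> \<le> r" "\<bar>snd v + snd (qmult k w t)\<bar> \<le> r"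
      using rN r1 by linarith+
    then show ?thesis by (simp add: mem_square)
  qed
  define \<phi> where "\<phi> = (\<lambda>(t, u, v). (quad k (u + qmult k p t), quad k u, quad k v, quad k (v + qmult k q t)))"
  have "inj_on \<phi> (square m \<times> square h \<times> square h)"
  proof (rule inj_onI)
    fix z z' assume "\<phi> z = \<phi> z'"
    moreover obtain t u v t' u' v' where "z = (t, u, v)" "z' = (t', u', v')" by (metis prod_cases3)
    ultimately show "z = z'"
      using p0 by (auto simp: \<phi>_def quad_add quad_mult quad_eq_iff[OF k])
  qed
  moreover have "\<phi> ` (square m \<times> square h \<times> square h) \<subseteq> ?F"
  proof (rule image_subsetI)
    fix z assume "z \<in> square m \<times> square h \<times> square h"
    then obtain t u v where z: "z = (t, u, v)" and tuv: "t \<in> square m" "u \<in> square h" "v \<in> square h"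
      by blast
    have sub: "w \<in> square r" if "w \<in> square h" for w
      using that r1 by (auto simp: mem_square h_def)
    have "quad k (u + qmult k p t) + x * quad k v = quad k u + x * quad k (v + qmult k q t)"
      using q0 by (simp add: quad_add quad_mult x_def field_simps)
    then show "\<phi> z \<in> ?F"
      using shift[OF p tuv(1,2)] shift[OF q tuv(1,3)] sub tuv by (simp add: \<phi>_def z A)
  qed
  moreover have "finite ?F"
    by (rule finite_subset[of _ "?A \<times> ?A \<times> ?A \<times> ?A"]) (auto simp: A)
  ultimately have "card (square m \<times> square h \<times> square h) \<le> card ?F"
    by (rule card_inj_on_le)
  then have "real (card (square m \<times> square h \<times> square h)) \<le> real (card ?F)" by (rule of_nat_mono)
  moreover have "real (card (square m \<times> square h \<times> square h)) = (2 * of_int m + 1)\<^sup>2 * (2 * of_int h + 1) ^ 4"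
    using m0 h0 by (simp add: card_cartesian_product card_square flip: power_add)
  moreover have "N ^ 3 / M / (256 * (1 + real k)\<^sup>2) \<le> (2 * of_int m + 1)\<^sup>2 * (2 * of_int h + 1) ^ 4"
  proof -
    have "N ^ 3 / M / (256 * (1 + real k)\<^sup>2) = B\<^sup>2 * (sqrt N / 2) ^ 4"
    proof -
      have "(sqrt N) ^ 4 = ((sqrt N)\<^sup>2)\<^sup>2" by (simp flip: power_mult)
      also have "\<dots> = N\<^sup>2" using MN by simp
      finally show ?thesis
        using MN unfolding B_def K_def[symmetric]
        by (simp add: power_divide power_mult_distrib) (simp add: power2_eq_square power3_eq_cube)
    qed
    also have "\<dots> \<le> (2 * of_int m + 1)\<^sup>2 * (2 * of_int h + 1) ^ 4"
    proof (intro mult_mono power_mono)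
      show "B \<le> 2 * of_int m + 1" using m0 unfolding m_def by linarith
      have "r \<le> 2 * h + 1" by (simp add: h_def)
      then show "sqrt N / 2 \<le> 2 * of_int h + 1" using rN r1 by linarith
    qed (use MN \<open>0 \<le> B\<close> in auto)
    finally show ?thesis .
  qed
  ultimately have "N ^ 3 / M / (256 * (1 + real k)\<^sup>2) \<le> real (card ?F)" by linarith
  then show ?thesis
    using x0 by (simp add: additive_energy_dilate flip: x_def)
qed

section \<open>A sieve for coprime norms\<close>

lemma card_spaced_le:
  fixes T :: "int set" and l a0 :: int
  assumes "l > 0" and T: "T \<subseteq> {a0..<a0 + int n}"
    and spaced: "\<And>x y. x \<in> T \<Longrightarrow> y \<in> T \<Longrightarrow> l dvd x - y"
  shows "real (card T) \<le> real n / of_int l + 1"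
proof (cases "T = {}")
  case False
  have fin: "finite T" using T finite_subset by blast
  define m where "m = Min T"
  have m: "m \<in> T" "\<And>x. x \<in> T \<Longrightarrow> m \<le> x"
    using fin False by (auto simp: m_def)
  have "inj_on (\<lambda>x. (x - m) div l) T"
  proof (rule inj_onI)
    fix x y assume xy: "x \<in> T" "y \<in> T" and eq: "(x - m) div l = (y - m) div l"
    have "x - m = l * ((x - m) div l)" using spaced[OF xy(1) m(1)] by simp
    also have "\<dots> = y - m" unfolding eq using spaced[OF xy(2) m(1)] by simp
    finally show "x = y" by simp
  qed
  moreover have "(\<lambda>x. (x - m) div l) ` T \<subseteq> {0..int n div l}"
  proof safe
    fix x assume x: "x \<in> T"
    have "x - m \<le> int n" "0 \<le> x - m" using subsetD[OF T x] subsetD[OF T m(1)] m(2)[OF x] by auto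
    then show "(x - m) div l \<in> {0..int n div l}"
      using \<open>l > 0\<close> by (auto intro: zdiv_mono1 simp: pos_imp_zdiv_nonneg_iff)
  qed
  ultimately have "card T \<le> card {0..int n div l}"
    by (metis card_inj_on_le finite_atLeastAtMost_int)
  also have "\<dots> = nat (int n div l + 1)" by simp
  finally have "real (card T) \<le> of_int (int n div l) + 1"
    using \<open>l > 0\<close> pos_imp_zdiv_nonneg_iff[of l "int n"] by linarith
  moreover have "of_int (int n div l) \<le> real n / of_int l"
    using real_of_int_div4[of "int n" l] by simp
  ultimately show ?thesis by linarith
qed (use \<open>l > 0\<close> in auto)

text \<open>
  Two solutions \<open>a, x\<close> satisfy \<open>l dvd Q (a - x) (2 + Q (a + x))\<close>, so the solutions lie in at most
  two residue classes modulo \<open>l\<close>.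
\<close>
lemma card_quadratic_roots_le:
  fixes l Q s a0 :: int
  assumes "prime l" "\<not> l dvd Q"
  shows "real (card {a \<in> {a0..<a0 + int n}. l dvd (1 + Q * a)\<^sup>2 - s}) \<le> 2 * (real n / of_int l + 1)"
    (is "real (card ?T) \<le> _")
proof (cases "?T = {}")
  case True
  then show ?thesis using prime_gt_0_int[OF assms(1)] by (subst True) simp
next
  case False
  then obtain x where x: "x \<in> ?T" by blast
  have cancel: "l dvd y" if "l dvd Q * y" for y
    using assms that by (simp add: prime_dvd_mult_iff)
  define T1 where "T1 = {a \<in> {a0..<a0 + int n}. l dvd a - x}"
  define T2 where "T2 = {a \<in> {a0..<a0 + int n}. l dvd 2 + Q * (a + x)}"
  have "?T \<subseteq> T1 \<union> T2"
  proof
    fix a assume a: "a \<in> ?T"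
    have "l dvd ((1 + Q * a)\<^sup>2 - s) - ((1 + Q * x)\<^sup>2 - s)"
      by (rule dvd_diff) (use a x in simp_all)
    also have "\<dots> = Q * (a - x) * (2 + Q * (a + x))"
      by (simp add: power2_eq_square algebra_simps)
    finally have "l dvd Q * (a - x) \<or> l dvd 2 + Q * (a + x)"
      using assms by (simp only: prime_dvd_mult_iff)
    then show "a \<in> T1 \<union> T2"
      using a cancel[of "a - x"] by (auto simp: T1_def T2_def)
  qed
  moreover have "finite (T1 \<union> T2)"
    by (rule finite_subset[of _ "{a0..<a0 + int n}"]) (auto simp: T1_def T2_def)
  ultimately have "card ?T \<le> card (T1 \<union> T2)"
    by (rule card_mono[rotated])
  also have "\<dots> \<le> card T1 + card T2" by (rule card_Un_le)
  finally have "real (card ?T) \<le> real (card T1) + real (card T2)" by linarith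
  moreover have "real (card T1) \<le> real n / of_int l + 1"
  proof (rule card_spaced_le)
    show "l dvd u - v" if "u \<in> T1" "v \<in> T1" for u v
      using that dvd_diff[of l "u - x" "v - x"] by (auto simp: T1_def)
  qed (use assms prime_gt_0_int in \<open>auto simp: T1_def\<close>)
  moreover have "real (card T2) \<le> real n / of_int l + 1"
  proof (rule card_spaced_le)
    show "l dvd u - v" if "u \<in> T2" "v \<in> T2" for u v
    proof (rule cancel)
      have "l dvd (2 + Q * (u + x)) - (2 + Q * (v + x))"
        using that by (intro dvd_diff) (auto simp: T2_def)
      then show "l dvd Q * (u - v)" by (simp add: algebra_simps)
    qed
  qed (use assms prime_gt_0_int in \<open>auto simp: T2_def\<close>)
  ultimately show ?thesis
    unfolding mult_2 by (meson add_mono order_trans)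
qed

text \<open>
  Telescoping, since \<open>1 / l\<^sup>2 \<le> 1 / (l - 1) - 1 / l\<close>.
\<close>
lemma sum_inverse_squares_le:
  fixes P :: int and L :: "int set"
  assumes "P > 0" "finite L" "\<And>l. l \<in> L \<Longrightarrow> l > P"
  shows "(\<Sum>l\<in>L. 1 / (of_int l)\<^sup>2) \<le> 1 / (of_int P :: real)"
proof -
  have tele: "(\<Sum>l\<in>{P<..P + int j}. 1 / (of_int l)\<^sup>2) \<le> 1 / of_int P - 1 / (of_int P + real j)" for j
  proof (induction j)
    case 0
    then show ?case by simp
  next
    case (Suc j)
    have ins: "{P<..P + int (Suc j)} = insert (P + int j + 1) {P<..P + int j}" by auto
    have "(\<Sum>l\<in>{P<..P + int (Suc j)}. 1 / (of_int l)\<^sup>2) =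
        1 / (of_int P + real j + 1)\<^sup>2 + (\<Sum>l\<in>{P<..P + int j}. 1 / (of_int l :: real)\<^sup>2)"
      unfolding ins by (subst sum.insert) auto
    also have "\<dots> \<le> 1 / (of_int P + real j + 1)\<^sup>2 + (1 / of_int P - 1 / (of_int P + real j))"
      using Suc by simp
    also have "\<dots> \<le> 1 / of_int P - 1 / (of_int P + real (Suc j))"
    proof -
      define x where "x = of_int P + real j"
      have x: "x > 0" using \<open>P > 0\<close> by (auto simp: x_def intro: add_pos_nonneg)
      have "1 / (x + 1)\<^sup>2 \<le> 1 / (x * (x + 1))"
        using x by (intro divide_left_mono) (auto simp: power2_eq_square)
      also have "\<dots> = 1 / x - 1 / (x + 1)"
        using x by (simp add: field_simps)
      finally show ?thesis by (simp add: x_def algebra_simps)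
    qed
    finally show ?case .
  qed
  define m where "m = nat (Max (insert (P + 1) L) - P)"
  have max: "l \<le> Max (insert (P + 1) L)" if "l \<in> insert (P + 1) L" for l
    using assms(2) that by (intro Max_ge) auto
  have "L \<subseteq> {P<..P + int m}"
    using assms(3) max max[of "P + 1"] by (force simp: m_def)
  then have "(\<Sum>l\<in>L. 1 / (of_int l)\<^sup>2) \<le> (\<Sum>l\<in>{P<..P + int m}. 1 / (of_int l :: real)\<^sup>2)"
    by (intro sum_mono2) auto
  also have "\<dots> \<le> 1 / of_int P - 1 / (of_int P + real m)" by (rule tele)
  also have "\<dots> \<le> 1 / of_int P" using \<open>P > 0\<close> by simp
  finally show ?thesis .
qed

lemma card_large_prime_divisors:
  fixes f :: int
  assumes "f \<noteq> 0" "n > 0" "\<bar>f\<bar> < int n ^ d" "finite L"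
    and L: "\<And>l. l \<in> L \<Longrightarrow> prime l \<and> l > int n \<and> l dvd f"
  shows "card L < d"
proof -
  have "\<Prod>L dvd f"
    using \<open>finite L\<close> L
  proof (induction L rule: finite_induct)
    case (insert l L)
    have "coprime l (\<Prod>L)"
      using insert by (intro prod_coprime_right) (metis insert_iff primes_coprime)
    then show ?case using insert by (simp add: divides_mult)
  qed simp
  then have "\<Prod>L \<le> \<bar>f\<bar>" using \<open>f \<noteq> 0\<close> by (simp add: dvd_imp_le_int abs_le_D1)
  moreover have "int n ^ card L \<le> \<Prod>L"
    using prod_mono[of L "\<lambda>_. int n" "\<lambda>l. l"] L by (auto simp: less_imp_le)
  ultimately have "int n ^ card L < int n ^ d" using assms by linarith
  then show ?thesis using \<open>n > 0\<close>
    by (meson leD le_less_linear of_nat_0_less_iff power_increasing int_one_le_iff_zero_less)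
qed

lemma card_mult_mono_real: "real (card A) \<le> x \<Longrightarrow> real (card B) \<le> y \<Longrightarrow> real (card (A \<times> B)) \<le> x * y"
  by (simp add: card_cartesian_product mult_mono)

text \<open>
  The points \<open>(u, v) = (1 + Q a, Q b)\<close> have values \<open>f = u\<^sup>2 - s v\<^sup>2 \<equiv> 1\<close> modulo \<open>Q\<close>, so only primes
  \<open>l > P\<close> can divide them, and \<open>l\<close> divides at most \<open>2 (n / l + 1) n\<close> of the \<open>n\<^sup>2\<close> values. For the
  pairs of values with a common prime factor, the primes \<open>l \<le> n\<close> contribute at most
  \<open>\<Sum> (4 n\<^sup>2 / l)\<^sup>2 \<le> 16 n\<^sup>4 / P\<close>. For \<open>l > n\<close> the bound \<open>4 n\<close> is too weak to be squared and summed
  over all \<open>l\<close>; but a nonzero value below \<open>n\<^sup>3\<close> has at most two such prime factors, so these primes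
  contribute at most \<open>4 n \<cdot> 2 n\<^sup>2\<close>. The points with \<open>u, v\<close> not coprime are treated in the same way;
  there a prime fixes both residue classes, and \<open>l dvd b\<close> forces \<open>l \<le> R\<close>.
\<close>
lemma sieve_lower_bound:
  fixes Q P s a0 b0 :: int and n :: nat and R :: real and f u v :: "int \<times> int \<Rightarrow> int"
  defines "G \<equiv> {a0..<a0 + int n} \<times> {b0..<b0 + int n}"
  defines "u \<equiv> \<lambda>(a, b). 1 + Q * a" and "v \<equiv> \<lambda>(a, b). Q * b"
  defines "f \<equiv> \<lambda>g. (u g)\<^sup>2 - s * (v g)\<^sup>2"
  assumes "P > 0" "n > 0"
    and Q: "\<And>l. prime l \<Longrightarrow> l \<le> P \<Longrightarrow> l dvd Q"
    and f: "\<And>g. g \<in> G \<Longrightarrow> f g \<noteq> 0 \<and> \<bar>f g\<bar> < int n ^ 3"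
    and b: "\<And>b. b \<in> {b0..<b0 + int n} \<Longrightarrow> 0 < b \<and> of_int b \<le> R"
  shows "real n ^ 4 * (1 - 20 / of_int P) - 8 * real n ^ 3 - R * real n ^ 2
    \<le> real (card {(g, h). g \<in> G \<and> h \<in> G \<and> coprime (f g) (f h) \<and> coprime (u g) (v g)})"
proof -
  have finG: "finite G" and cardG: "card G = n\<^sup>2"
    by (auto simp: G_def card_cartesian_product power2_eq_square)
  define L where "L = {l::int. prime l \<and> \<not> l dvd Q \<and> l \<le> int n ^ 3}"
  define Ls where "Ls = {l \<in> L. l \<le> int n}"
  define Ll where "Ll = {l \<in> L. int n < l}"
  define D where "D l = {g \<in> G. l dvd f g}" for l
  have Lpos: "l > 0" if "l \<in> L" for l using that prime_gt_0_int by (auto simp: L_def)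
  have LP: "l > P" if "l \<in> L" for l
    using that Q[of l] by (cases "l \<le> P") (auto simp: L_def)
  have "L \<subseteq> {0..int n ^ 3}"
    using prime_ge_0_int by (auto simp: L_def)
  then have finL: "finite L" by (rule finite_subset) simp
  have finLs: "finite Ls" and finLl: "finite Ll" using finL by (auto simp: Ls_def Ll_def)
  have finD: "finite (D l)" for l using finG by (auto simp: D_def)
  have sumsq: "(\<Sum>l\<in>Ls. 1 / (of_int l)\<^sup>2) \<le> 1 / (of_int P :: real)"
    using sum_inverse_squares_le[of P Ls] \<open>P > 0\<close> finLs LP by (auto simp: Ls_def)
  have not_dvd_Q: "\<not> l dvd Q" if "prime l" "l dvd f g" "g \<in> G" for l g
  proof
    assume "l dvd Q"
    obtain a b where g: "g = (a, b)" by force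
    have "f g = 1 + Q * (2 * a + Q * a\<^sup>2 - s * Q * b\<^sup>2)"
      by (simp add: g f_def u_def v_def power2_eq_square algebra_simps)
    then have "l dvd 1" using that(2) \<open>l dvd Q\<close>
      by (metis dvd_add_left_iff dvd_mult2)
    then show False using that(1) not_prime_unit by blast
  qed
  have inL: "l \<in> L" if "prime l" "l dvd f g" "g \<in> G" for l g
  proof -
    have "l \<le> \<bar>f g\<bar>" using that f[of g] by (simp add: dvd_imp_le_int abs_le_D1)
    then show ?thesis using that f[of g] not_dvd_Q[OF that] by (simp add: L_def)
  qed

  have cardD: "real (card (D l)) \<le> 2 * (real n / of_int l + 1) * real n" if l: "l \<in> L" for l
  proof -
    define T where "T b = {a \<in> {a0..<a0 + int n}. l dvd (1 + Q * a)\<^sup>2 - s * (Q * b)\<^sup>2}" for b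
    have finT: "finite (T b)" for b
      by (rule finite_subset[of _ "{a0..<a0 + int n}"]) (auto simp: T_def)
    have "D l = (\<lambda>(b, a). (a, b)) ` (SIGMA b:{b0..<b0 + int n}. T b)"
      by (force simp: D_def T_def G_def f_def u_def v_def)
    then have "card (D l) \<le> card (SIGMA b:{b0..<b0 + int n}. T b)"
      using finT by (auto intro!: card_image_le simp del: card_SigmaI)
    also have "\<dots> = (\<Sum>b\<in>{b0..<b0 + int n}. card (T b))"
      using finT by (intro card_SigmaI) auto
    finally have "real (card (D l)) \<le> (\<Sum>b\<in>{b0..<b0 + int n}. real (card (T b)))"
      by (simp flip: of_nat_sum)
    also have "\<dots> \<le> (\<Sum>b\<in>{b0..<b0 + int n}. 2 * (real n / of_int l + 1))"
      unfolding T_def by (intro sum_mono card_quadratic_roots_le) (use l in \<open>auto simp: L_def\<close>)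
    also have "\<dots> = 2 * (real n / of_int l + 1) * real n" by simp
    finally show ?thesis .
  qed
  have cardD_small: "real (card (D l)) \<le> 4 * real n ^ 2 / of_int l" if l: "l \<in> Ls" for l
  proof -
    have "0 < l" "l \<le> int n" using l Lpos[of l] by (auto simp: Ls_def)
    then have "1 \<le> real n / of_int l" by simp
    then have "2 * (real n / of_int l + 1) * real n \<le> 2 * (2 * (real n / of_int l)) * real n"
      by (intro mult_mono) auto
    then show ?thesis using cardD[of l] l by (simp add: Ls_def power2_eq_square)
  qed
  have cardD_large: "real (card (D l)) \<le> 4 * real n" if l: "l \<in> Ll" for l
  proof -
    have "real n / of_int l \<le> 1" using l Lpos[of l] by (simp add: Ll_def)
    then have "2 * (real n / of_int l + 1) * real n \<le> 2 * 2 * real n"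
      by (intro mult_right_mono) auto
    then show ?thesis using cardD[of l] l by (simp add: Ll_def)
  qed
  have sumD_large: "(\<Sum>l\<in>Ll. card (D l)) \<le> 2 * n\<^sup>2"
  proof -
    have "(\<Sum>l\<in>Ll. card (D l)) = (\<Sum>g\<in>G. card {l \<in> Ll. l dvd f g})"
      unfolding D_def by (rule sum_multicount_gen) (use finG finLl in auto)
    also have "\<dots> \<le> (\<Sum>g\<in>G. 2)"
    proof (rule sum_mono)
      fix g assume "g \<in> G"
      have "card {l \<in> Ll. l dvd f g} < 3"
        by (rule card_large_prime_divisors[where f = "f g" and n = n])
          (use f[OF \<open>g \<in> G\<close>] \<open>n > 0\<close> finLl in \<open>auto simp: Ll_def L_def\<close>)
      then show "card {l \<in> Ll. l dvd f g} \<le> 2" by simp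
    qed
    finally show ?thesis by (simp add: cardG)
  qed

  define B1 where "B1 = {(g, h). g \<in> G \<and> h \<in> G \<and> \<not> coprime (f g) (f h)}"
  have "B1 \<subseteq> (\<Union>l\<in>L. D l \<times> D l)"
  proof
    fix z assume "z \<in> B1"
    then obtain g h where z: "z = (g, h)" "g \<in> G" "h \<in> G" "\<not> coprime (f g) (f h)"
      by (auto simp: B1_def)
    obtain l where "prime l" "l dvd gcd (f g) (f h)"
      using z(4) prime_factor_int[of "gcd (f g) (f h)"] by (auto simp: coprime_iff_gcd_eq_1)
    then show "z \<in> (\<Union>l\<in>L. D l \<times> D l)" using inL[of l g] z by (auto simp: D_def)
  qed
  then have "card B1 \<le> card (\<Union>l\<in>L. D l \<times> D l)"
    by (intro card_mono) (use finL finD in auto)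
  also have "\<dots> \<le> (\<Sum>l\<in>L. card (D l \<times> D l))" by (rule card_UN_le[OF finL])
  also have "\<dots> = (\<Sum>l\<in>L. (card (D l))\<^sup>2)" by (simp add: card_cartesian_product power2_eq_square)
  also have "\<dots> = (\<Sum>l\<in>Ls. (card (D l))\<^sup>2) + (\<Sum>l\<in>Ll. (card (D l))\<^sup>2)"
    by (subst sum.union_disjoint[symmetric]) (use finLs finLl in \<open>auto simp: Ls_def Ll_def intro!: sum.cong\<close>)
  finally have "real (card B1) \<le> (\<Sum>l\<in>Ls. (real (card (D l)))\<^sup>2) + (\<Sum>l\<in>Ll. (real (card (D l)))\<^sup>2)"
    by (simp flip: of_nat_sum of_nat_power of_nat_add)
  moreover have "(\<Sum>l\<in>Ls. (real (card (D l)))\<^sup>2) \<le> 16 * real n ^ 4 / of_int P"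
  proof -
    have "(\<Sum>l\<in>Ls. (real (card (D l)))\<^sup>2) \<le> (\<Sum>l\<in>Ls. (4 * real n ^ 2 / of_int l)\<^sup>2)"
      by (intro sum_mono power_mono cardD_small) auto
    also have "\<dots> = 16 * real n ^ 4 * (\<Sum>l\<in>Ls. 1 / (of_int l)\<^sup>2)"
      by (simp add: sum_distrib_left power_divide power_mult_distrib)
    also have "\<dots> \<le> 16 * real n ^ 4 * (1 / of_int P)"
      by (intro mult_left_mono sumsq) auto
    finally show ?thesis by simp
  qed
  moreover have "(\<Sum>l\<in>Ll. (real (card (D l)))\<^sup>2) \<le> 8 * real n ^ 3"
  proof -
    have "(\<Sum>l\<in>Ll. (real (card (D l)))\<^sup>2) \<le> (\<Sum>l\<in>Ll. 4 * real n * real (card (D l)))"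
      unfolding power2_eq_square by (intro sum_mono mult_right_mono cardD_large) auto
    also have "\<dots> = 4 * real n * real (\<Sum>l\<in>Ll. card (D l))" by (simp add: sum_distrib_left)
    also have "\<dots> \<le> 4 * real n * real (2 * n\<^sup>2)"
      by (intro mult_left_mono of_nat_mono sumD_large) auto
    finally show ?thesis by (simp add: power2_eq_square power3_eq_cube)
  qed
  ultimately have B1: "real (card B1) \<le> 16 * real n ^ 4 / of_int P + 8 * real n ^ 3" by linarith

  define B2 where "B2 = {g \<in> G. \<not> coprime (u g) (v g)}"
  define LR where "LR = {l \<in> Ll. of_int l \<le> R}"
  define Ta where "Ta l = {a \<in> {a0..<a0 + int n}. l dvd 1 + Q * a}" for l
  define Tb where "Tb l = {b \<in> {b0..<b0 + int n}. l dvd b}" for l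
  have finT: "finite (Ta l \<times> Tb l)" for l
    by (rule finite_subset[of _ "{a0..<a0 + int n} \<times> {b0..<b0 + int n}"]) (auto simp: Ta_def Tb_def)
  have cardTa: "real (card (Ta l)) \<le> real n / of_int l + 1" if l: "l \<in> L" for l
  proof (rule card_spaced_le)
    show "l dvd x - y" if "x \<in> Ta l" "y \<in> Ta l" for x y
    proof -
      have "l dvd (1 + Q * x) - (1 + Q * y)"
        using that by (intro dvd_diff) (auto simp: Ta_def)
      then have "l dvd Q * (x - y)" by (simp add: algebra_simps)
      then show ?thesis using l by (simp add: L_def prime_dvd_mult_iff)
    qed
  qed (use Lpos[OF l] in \<open>auto simp: Ta_def\<close>)
  have cardTb: "real (card (Tb l)) \<le> real n / of_int l + 1" if l: "l \<in> L" for l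
    by (rule card_spaced_le) (use Lpos[OF l] in \<open>auto simp: Tb_def\<close>)
  have cardT: "real (card (Ta l \<times> Tb l)) \<le> (real n / of_int l + 1)\<^sup>2" if l: "l \<in> L" for l
    using card_mult_mono_real[OF cardTa[OF l] cardTb[OF l]] by (simp add: power2_eq_square)
  have finLR: "finite LR" using finLl by (simp add: LR_def)
  have "B2 \<subseteq> (\<Union>l\<in>Ls \<union> LR. Ta l \<times> Tb l)"
  proof
    fix g assume "g \<in> B2"
    then obtain a b where g: "g = (a, b)" "g \<in> G" "\<not> coprime (1 + Q * a) (Q * b)"
      by (cases g) (auto simp: B2_def u_def v_def)
    obtain l where l: "prime l" "l dvd gcd (1 + Q * a) (Q * b)"
      using g(3) prime_factor_int[of "gcd (1 + Q * a) (Q * b)"] by (auto simp: coprime_iff_gcd_eq_1)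
    have "l dvd f g" using l(2) by (auto simp: g f_def u_def v_def power2_eq_square)
    then have "l \<in> L" using inL l g by auto
    then have "l dvd b" using l by (auto simp: L_def prime_dvd_mult_iff)
    moreover have b': "b \<in> {b0..<b0 + int n}" using g by (auto simp: G_def)
    ultimately have "of_int l \<le> R" using b[OF b'] zdvd_imp_le[of l b] by linarith
    then have "l \<in> Ls \<union> LR" using \<open>l \<in> L\<close> by (auto simp: Ls_def LR_def Ll_def)
    moreover have "g \<in> Ta l \<times> Tb l"
      using g l \<open>l dvd b\<close> by (auto simp: Ta_def Tb_def G_def)
    ultimately show "g \<in> (\<Union>l\<in>Ls \<union> LR. Ta l \<times> Tb l)" by blast
  qed
  then have "card B2 \<le> card (\<Union>l\<in>Ls \<union> LR. Ta l \<times> Tb l)"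
    by (intro card_mono) (use finLs finLR finT in auto)
  also have "\<dots> \<le> (\<Sum>l\<in>Ls \<union> LR. card (Ta l \<times> Tb l))"
    by (rule card_UN_le) (use finLs finLR in auto)
  also have "\<dots> = (\<Sum>l\<in>Ls. card (Ta l \<times> Tb l)) + (\<Sum>l\<in>LR. card (Ta l \<times> Tb l))"
    by (rule sum.union_disjoint) (use finLs finLR in \<open>auto simp: Ls_def LR_def Ll_def\<close>)
  finally have "real (card B2) \<le> (\<Sum>l\<in>Ls. real (card (Ta l \<times> Tb l))) + (\<Sum>l\<in>LR. real (card (Ta l \<times> Tb l)))"
    by (simp only: flip: of_nat_sum of_nat_add)
  moreover have "(\<Sum>l\<in>Ls. real (card (Ta l \<times> Tb l))) \<le> 4 * real n ^ 2 / of_int P"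
  proof -
    have "(\<Sum>l\<in>Ls. real (card (Ta l \<times> Tb l))) \<le> (\<Sum>l\<in>Ls. 4 * real n ^ 2 * (1 / (of_int l)\<^sup>2))"
    proof (rule sum_mono)
      fix l assume l: "l \<in> Ls"
      then have "0 < l" "l \<le> int n" using Lpos[of l] by (auto simp: Ls_def)
      then have "1 \<le> real n / of_int l" by simp
      then have "(real n / of_int l + 1)\<^sup>2 \<le> (2 * (real n / of_int l))\<^sup>2"
        by (intro power_mono) auto
      then show "real (card (Ta l \<times> Tb l)) \<le> 4 * real n ^ 2 * (1 / (of_int l)\<^sup>2)"
        using cardT[of l] l by (simp add: Ls_def power_divide power_mult_distrib)
    qed
    also have "\<dots> = 4 * real n ^ 2 * (\<Sum>l\<in>Ls. 1 / (of_int l)\<^sup>2)" by (simp add: sum_distrib_left)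
    also have "\<dots> \<le> 4 * real n ^ 2 * (1 / of_int P)"
      by (intro mult_left_mono sumsq) auto
    finally show ?thesis by simp
  qed
  moreover have "(\<Sum>l\<in>LR. real (card (Ta l \<times> Tb l))) \<le> R"
  proof -
    have "R \<ge> 0" using b[of b0] \<open>n > 0\<close> by simp
    have "(\<Sum>l\<in>LR. real (card (Ta l \<times> Tb l))) \<le> (\<Sum>l\<in>LR. 1)"
    proof (rule sum_mono)
      fix l assume "l \<in> LR"
      then have l: "l \<in> L" "int n < l" by (auto simp: LR_def Ll_def)
      then have "real n / of_int l < 1" using Lpos[of l] by simp
      then have "card (Ta l) \<le> 1" "card (Tb l) \<le> 1" using cardTa[OF l(1)] cardTb[OF l(1)] by linarith+
      then show "real (card (Ta l \<times> Tb l)) \<le> 1"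
        using mult_le_mono[of "card (Ta l)" 1 "card (Tb l)" 1] by (simp add: card_cartesian_product flip: of_nat_mult)
    qed
    also have "\<dots> = real (card LR)" by simp
    also have "\<dots> \<le> real (card {1..\<lfloor>R\<rfloor>})"
      by (intro of_nat_mono card_mono) (auto simp: LR_def Ll_def le_floor_iff)
    also have "\<dots> \<le> R" using \<open>R \<ge> 0\<close> by simp
    finally show ?thesis .
  qed
  ultimately have B2: "real (card B2) \<le> 4 * real n ^ 2 / of_int P + R" by linarith

  define good where "good = {(g, h). g \<in> G \<and> h \<in> G \<and> coprime (f g) (f h) \<and> coprime (u g) (v g)}"
  have "G \<times> G \<subseteq> good \<union> (B1 \<union> B2 \<times> G)" by (auto simp: good_def B1_def B2_def)
  moreover have "finite (good \<union> (B1 \<union> B2 \<times> G))"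
    by (rule finite_subset[of _ "G \<times> G"]) (use finG in \<open>auto simp: good_def B1_def B2_def\<close>)
  ultimately have "card (G \<times> G) \<le> card (good \<union> (B1 \<union> B2 \<times> G))" by (rule card_mono[rotated])
  also have "\<dots> \<le> card good + (card B1 + card (B2 \<times> G))"
    by (intro order.trans[OF card_Un_le] add_mono order.refl card_Un_le)
  finally have "n ^ 4 \<le> card good + card B1 + card B2 * n\<^sup>2"
    by (simp add: card_cartesian_product cardG flip: power_add)
  then have "real (n ^ 4) \<le> real (card good + card B1 + card B2 * n\<^sup>2)"
    by (rule of_nat_mono)
  then have "real n ^ 4 \<le> real (card good) + real (card B1) + real (card B2) * real n ^ 2"
    by simp
  also have "real (card B2) * real n ^ 2 \<le> (4 * real n ^ 2 / of_int P + R) * real n ^ 2"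
    by (intro mult_right_mono B2) auto
  finally have "real n ^ 4 \<le> real (card good) + (16 * real n ^ 4 / of_int P + 8 * real n ^ 3)
      + (4 * real n ^ 2 / of_int P + R) * real n ^ 2"
    using B1 by linarith
  moreover have "(4 * real n ^ 2 / of_int P + R) * real n ^ 2 = 4 * real n ^ 4 / of_int P + R * real n ^ 2"
    by (simp add: algebra_simps flip: power_add)
  ultimately show ?thesis unfolding good_def[symmetric] by (simp add: algebra_simps)
qed

section \<open>The number of quotients\<close>

definition lattice_shell :: "real \<Rightarrow> real \<Rightarrow> (int \<times> int) set" where
  "lattice_shell c R = {z. c * R \<le> \<bar>of_int (fst z)\<bar> \<and> \<bar>of_int (fst z)\<bar> \<le> R \<and>
     c * R \<le> \<bar>of_int (snd z)\<bar> \<and> \<bar>of_int (snd z)\<bar> \<le> R}"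

lemma S_set_eq:
  "S_set k c M = {quad k p / quad k q | p q. p \<in> lattice_shell c (sqrt M) \<and> q \<in> lattice_shell c (sqrt M) \<and>
     gcd (qnorm k p) (qnorm k q) \<le> 5 \<and> gcd (fst p) (snd p) \<le> 5}"
  by (fastforce simp: S_set_def quad_def qnorm_def lattice_shell_def)

lemma lattice_shell_subset: "lattice_shell c R \<subseteq> square \<lfloor>R\<rfloor>"
  by (auto simp: lattice_shell_def mem_square) linarith+

lemma S_set_subset:
  "S_set k c M \<subseteq> (\<lambda>(p, q). quad k p / quad k q) ` (square \<lfloor>sqrt M\<rfloor> \<times> square \<lfloor>sqrt M\<rfloor>)"
  unfolding S_set_eq using lattice_shell_subset by fastforce

lemma finite_S_set: "finite (S_set k c M)"
  by (rule finite_subset[OF S_set_subset]) simp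

lemma card_S_set_le:
  assumes "M \<ge> 0"
  shows "real (card (S_set k c M)) \<le> (2 * of_int \<lfloor>sqrt M\<rfloor> + 1) ^ 4"
proof -
  have "card (S_set k c M) \<le> card (square \<lfloor>sqrt M\<rfloor> \<times> square \<lfloor>sqrt M\<rfloor>)"
    by (intro order.trans[OF card_mono[OF _ S_set_subset] card_image_le]) simp_all
  then have "real (card (S_set k c M)) \<le> real (card (square \<lfloor>sqrt M\<rfloor> \<times> square \<lfloor>sqrt M\<rfloor>))"
    by (rule of_nat_mono)
  also have "\<dots> = (2 * of_int \<lfloor>sqrt M\<rfloor> + 1) ^ 4"
    using assms by (simp add: card_cartesian_product card_square flip: power_add)
  finally show ?thesis .
qed

text \<open>
  For \<open>k c\<^sup>2 > 1\<close> the two terms of the norm cannot cancel in the shell.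
\<close>
lemma qnorm_shell_ge:
  assumes "0 < c" "0 \<le> R" "z \<in> lattice_shell c R"
  shows "(real k * c\<^sup>2 - 1) * R\<^sup>2 \<le> \<bar>real_of_int (qnorm k z)\<bar>"
proof -
  have "(real_of_int (fst z))\<^sup>2 \<le> R\<^sup>2"
    using assms power_mono[of "\<bar>real_of_int (fst z)\<bar>" R 2] by (simp add: lattice_shell_def)
  moreover have "(c * R)\<^sup>2 \<le> (real_of_int (snd z))\<^sup>2"
    using assms power_mono[of "c * R" "\<bar>real_of_int (snd z)\<bar>" 2] by (simp add: lattice_shell_def)
  then have "real k * (c * R)\<^sup>2 \<le> real k * (real_of_int (snd z))\<^sup>2"
    by (rule mult_left_mono) simp
  ultimately have "real k * (c * R)\<^sup>2 - R\<^sup>2 \<le> - real_of_int (qnorm k z)"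
    by (simp add: qnorm_def)
  then show ?thesis by (simp add: algebra_simps power_mult_distrib)
qed

definition qconj :: "int \<times> int \<Rightarrow> int \<times> int" where
  "qconj z = (fst z, - snd z)"

lemma qconj_qmult: "qconj (qmult k z w) = qmult k (qconj z) (qconj w)"
  by (simp add: qconj_def qmult_def)

lemma ratio_bounds:
  fixes lo hi a b t :: real
  assumes "0 < lo" "lo \<le> a" "a \<le> hi" "lo \<le> b" "b \<le> hi" "2 * hi < 3 * lo" "a * t = b"
  shows "2 / 3 < t" "t < 3 / 2"
proof -
  have t: "t = b / a" using assms by (simp add: field_simps)
  show "2 / 3 < t" "t < 3 / 2" using assms(1-6) by (simp_all add: t field_simps)
qed

text \<open>
  The bounds on \<open>c\<close> put the positive elements of the shell within a factor \<open>3/2\<close> of each other, and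
  likewise their conjugates. So the common multiplier \<open>t\<close> and its conjugate lie strictly between
  \<open>2/3\<close> and \<open>3/2\<close>; half their sum is the first coordinate of \<open>t\<close>, which must be \<open>1\<close>, and their
  difference is too small for the second coordinate to be nonzero.
\<close>
lemma quotient_determines_pair:
  fixes p q p' q' :: "int \<times> int" and c R :: real
  assumes k: "\<nexists>m::nat. k = m\<^sup>2" "1 < sqrt (real k)"
    and c: "2 * sqrt (real k) + 3 < c * (3 * sqrt (real k) + 2)" "2 < 3 * c" "1 < c * sqrt (real k)" and "0 < R"
    and pos: "\<And>z. z \<in> {p, q, p', q'} \<Longrightarrow> c * R \<le> of_int (fst z) \<and> of_int (fst z) \<le> R \<and>
      c * R \<le> of_int (snd z) \<and> of_int (snd z) \<le> R"
    and cop: "coprime (qnorm k p) (qnorm k q)"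
    and eq: "quad k p / quad k q = quad k p' / quad k q'"
  shows "p = p' \<and> q = q'"
proof -
  define s where "s = sqrt (real k)"
  have "0 < c" using c by simp
  have s: "1 < s" using k by (simp add: s_def)
  have real_bounds: "c * R * (1 + s) \<le> quad k z" "quad k z \<le> R * (1 + s)" 
    and conj_bounds: "R * (c * s - 1) \<le> - quad k (qconj z)" "- quad k (qconj z) \<le> R * (s - c)"
    if "z \<in> {p, q, p', q'}" for z
  proof -
    have "c * R * s \<le> of_int (snd z) * s" "of_int (snd z) * s \<le> R * s"
      using pos[OF that] s by (auto intro: mult_right_mono)
    then show "c * R * (1 + s) \<le> quad k z" "quad k z \<le> R * (1 + s)"
      "R * (c * s - 1) \<le> - quad k (qconj z)" "- quad k (qconj z) \<le> R * (s - c)"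
      using pos[OF that] by (simp_all add: quad_def qconj_def algebra_simps flip: s_def)
  qed
  have "0 < c * R * (1 + s)" using \<open>0 < c\<close> \<open>0 < R\<close> s by simp
  then have "quad k q \<noteq> 0" "quad k q' \<noteq> 0" using real_bounds(1)[of q] real_bounds(1)[of q'] by force+
  then have "quad k q * quad k p' = quad k p * quad k q'"
    using eq by (simp add: field_simps)
  then have "qmult k q p' = qmult k p q'"
    by (simp add: quad_eq_iff[OF k(1)] flip: quad_mult)
  then obtain t where t: "qmult k q t = q'" "qmult k p t = p'"
    using qmult_gcd_quotient[of k q p' p q'] cop by (auto simp: coprime_iff_gcd_eq_1)
  have T: "quad k q * quad k t = quad k q'"
    using t(1) by (simp flip: quad_mult)
  have "qmult k (qconj q) (qconj t) = qconj q'"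
    using t(1) by (simp flip: qconj_qmult)
  then have T': "- quad k (qconj q) * quad k (qconj t) = - quad k (qconj q')"
    by (simp flip: quad_mult)
  have "2 / 3 < quad k t" "quad k t < 3 / 2"
  proof -
    have "0 < R * (1 + s)" using \<open>0 < R\<close> s by simp
    then have "2 * (R * (1 + s)) < 3 * c * (R * (1 + s))"
      using c(2) by (rule mult_strict_right_mono[rotated])
    then have "2 * (R * (1 + s)) < 3 * (c * R * (1 + s))" by (simp only: mult.assoc)
    then show "2 / 3 < quad k t" "quad k t < 3 / 2"
      using ratio_bounds[OF _ _ _ _ _ _ T, of "c * R * (1 + s)" "R * (1 + s)"] \<open>0 < c * R * (1 + s)\<close>
        real_bounds[of q] real_bounds[of q'] by simp_all
  qed
  moreover have "2 / 3 < quad k (qconj t)" "quad k (qconj t) < 3 / 2"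
  proof -
    have "0 < R * (c * s - 1)" using \<open>0 < R\<close> c(3) by (simp add: s_def)
    moreover have "2 * (R * (s - c)) < 3 * (R * (c * s - 1))"
      using mult_strict_left_mono[OF c(1), of R] \<open>0 < R\<close> by (simp add: algebra_simps s_def)
    ultimately show "2 / 3 < quad k (qconj t)" "quad k (qconj t) < 3 / 2"
      using ratio_bounds[OF _ _ _ _ _ _ T', of "R * (c * s - 1)" "R * (s - c)"]
        conj_bounds[of q] conj_bounds[of q'] by simp_all
  qed
  moreover have "quad k t = of_int (fst t) + of_int (snd t) * s"
    "quad k (qconj t) = of_int (fst t) - of_int (snd t) * s"
    by (simp_all add: quad_def qconj_def s_def)
  ultimately have "1 < 2 * real_of_int (fst t)" "2 * real_of_int (fst t) < 3"
    "\<bar>real_of_int (snd t) * s\<bar> < 1" by linarith+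
  then have "fst t = 1" by linarith
  moreover have "snd t = 0"
  proof (rule ccontr)
    assume "snd t \<noteq> 0"
    then have "1 \<le> \<bar>real_of_int (snd t)\<bar>" by linarith
    then have "1 * 1 \<le> \<bar>real_of_int (snd t)\<bar> * s" using s by (intro mult_mono) auto
    then show False using \<open>\<bar>real_of_int (snd t) * s\<bar> < 1\<close> s by (simp add: abs_mult)
  qed
  ultimately show ?thesis using t by (auto simp: qmult_def prod_eq_iff)
qed

text \<open>
  The sieve is applied to the points of \<open>[c R, R]\<^sup>2\<close> congruent to \<open>(1, 0)\<close> modulo \<open>Q\<close>. They form an
  \<open>n\<close> by \<open>n\<close> grid where \<open>n\<close> is proportional to \<open>R\<close>, so that norms are \<open>O(n\<^sup>2)\<close> and below \<open>n\<^sup>3\<close> for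
  large \<open>n\<close>.
\<close>
lemma many_coprime_norms:
  fixes c :: real
  assumes k: "\<nexists>m::nat. k = m\<^sup>2" and c: "0 < c" "c < 1"
  obtains \<kappa> D :: real where "\<kappa> > 0" "D > 0"
    "\<And>R. R \<ge> D \<Longrightarrow> \<kappa> * R ^ 4 \<le> real (card {(p, q).
      (\<forall>z\<in>{p, q}. c * R \<le> of_int (fst z) \<and> of_int (fst z) \<le> R \<and> c * R \<le> of_int (snd z) \<and> of_int (snd z) \<le> R) \<and>
      coprime (qnorm k p) (qnorm k q) \<and> coprime (fst p) (snd p)})"
proof -
  \<comment> \<open>With \<open>P = 80\<close> the main term of the sieve is \<open>(1 - 20/80) n\<^sup>4\<close>.\<close>
  define Q where "Q = \<Prod>{1..80::int}"
  have Q: "l dvd Q" if "prime l" "l \<le> 80" for l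
  proof -
    have "l \<in> {1..80}" using that prime_gt_0_int[of l] by simp
    then show ?thesis unfolding Q_def using dvd_prodI[of "{1..80::int}" l "\<lambda>x. x"] by simp
  qed
  have "Q > 0" unfolding Q_def by (rule prod_pos) simp
  then have Q0: "real_of_int Q > 0" by simp
  define C where "C = 2 * of_int Q / (1 - c)"
  have C0: "C > 0" using Q0 c by (simp add: C_def)
  \<comment> \<open>Since \<open>R \<le> C n\<close>, norms are at most \<open>(1 + k) C\<^sup>2 n\<^sup>2\<close>, which is below \<open>n\<^sup>3\<close> for \<open>n \<ge> n0\<close>; the summand
    \<open>4 (8 + C)\<close> makes the lower order terms of the sieve at most \<open>n\<^sup>4 / 4\<close>.\<close>
  define n0 where "n0 = (1 + real k) * C\<^sup>2 + 4 * (8 + C) + 1"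
  have n0: "n0 \<ge> 1" "n0 > (1 + real k) * C\<^sup>2" "n0 \<ge> 4 * (8 + C)"
    using C0 by (simp_all add: n0_def add_nonneg_nonneg)
  show ?thesis
  proof (rule that[of "1 / (2 * C ^ 4)" "C * n0"])
    show "1 / (2 * C ^ 4) > 0" "C * n0 > 0" using C0 n0 by simp_all
    fix R assume R: "R \<ge> C * n0"
    let ?W = "{(p, q). (\<forall>z\<in>{p, q}. c * R \<le> of_int (fst z) \<and> of_int (fst z) \<le> R \<and> c * R \<le> of_int (snd z) \<and> of_int (snd z) \<le> R) \<and>
      coprime (qnorm k p) (qnorm k q) \<and> coprime (fst p) (snd p)}"
    define W where "W = ?W"
    define y where "y = (1 - c) * R / of_int Q"
    have y: "R = C * (y / 2)" using c \<open>Q > 0\<close> by (simp add: y_def C_def)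
    have "C * n0 \<le> C * (y / 2)" using R by (simp only: y)
    then have yn0: "y / 2 \<ge> n0" using C0 by (simp only: mult_le_cancel_left_pos)
    define n where "n = nat \<lfloor>y\<rfloor>"
    have ny: "real n \<le> y" "y / 2 \<le> real n"
      using yn0 n0(1) by (auto simp: n_def) linarith+
    have nn0: "real n \<ge> n0" using ny yn0 by linarith
    have n: "n > 0" using nn0 n0(1) by (cases n) auto
    have R0: "R > 0" using R mult_pos_pos[OF C0, of n0] n0(1) by linarith
    have RC: "R \<le> C * real n" unfolding y using C0 ny by simp
    have Qn: "of_int Q * real n \<le> (1 - c) * R"
      using ny(1) Q0 by (simp add: y_def field_simps)
    \<comment> \<open>The smallest \<open>a, b\<close> with \<open>1 + Q a \<ge> c R\<close> and \<open>Q b \<ge> c R\<close>; as \<open>Q n \<le> (1 - c) R\<close>, the next \<open>n\<close>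
      values stay below \<open>R\<close>.\<close>
    define a0 where "a0 = \<lceil>(c * R - 1) / of_int Q\<rceil>"
    define b0 where "b0 = \<lceil>c * R / of_int Q\<rceil>"
    have range: "w \<le> of_int Q * of_int i \<and> of_int Q * of_int i \<le> w + (1 - c) * R"
      if "i \<in> {\<lceil>w / of_int Q\<rceil>..<\<lceil>w / of_int Q\<rceil> + int n}" for w i
    proof
      have "w / of_int Q \<le> of_int i" using that by (auto simp: ceiling_le_iff)
      then show "w \<le> of_int Q * of_int i" using Q0 by (simp add: field_simps)
      have "real_of_int i \<le> w / of_int Q + real n"
        using that ceiling_correct[of "w / of_int Q"] by simp
      then have "of_int Q * real_of_int i \<le> of_int Q * (w / of_int Q + real n)"
        using Q0 by (intro mult_left_mono) auto
      also have "\<dots> = w + of_int Q * real n" using Q0 by (simp add: field_simps)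
      finally show "of_int Q * of_int i \<le> w + (1 - c) * R" using Qn by linarith
    qed
    define G where "G = {a0..<a0 + int n} \<times> {b0..<b0 + int n}"
    define z where "z = (\<lambda>(a, b). (1 + Q * a, Q * b))"
    have zG: "c * R \<le> of_int (fst (z g)) \<and> of_int (fst (z g)) \<le> R \<and> c * R \<le> of_int (snd (z g)) \<and> of_int (snd (z g)) \<le> R"
      if "g \<in> G" for g
      using that range[of "fst g" "c * R - 1"] range[of "snd g" "c * R"]
      by (cases g) (auto simp: G_def z_def a0_def b0_def algebra_simps)
    have bpos: "0 < b \<and> of_int b \<le> R" if b: "b \<in> {b0..<b0 + int n}" for b
    proof -
      have "0 < c * R" using c R0 by simp
      then have "0 < real_of_int Q * of_int b" using range[of b "c * R"] b by (simp add: b0_def)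
      then have "0 < b" using \<open>Q > 0\<close> by (simp add: zero_less_mult_iff)
      moreover have "b \<le> Q * b" using \<open>0 < b\<close> \<open>Q > 0\<close> by simp
      then have "real_of_int b \<le> of_int Q * of_int b" by (metis of_int_le_iff of_int_mult)
      moreover have "of_int Q * of_int b \<le> R" using range[of b "c * R"] b by (simp add: b0_def algebra_simps)
      ultimately show ?thesis by linarith
    qed
    have norm: "qnorm k (z g) \<noteq> 0 \<and> \<bar>qnorm k (z g)\<bar> < int n ^ 3" if g: "g \<in> G" for g
    proof
      have "0 < c * R" using c R0 by simp
      then have "z g \<noteq> 0" using zG[OF g] by auto
      then show "qnorm k (z g) \<noteq> 0" using qnorm_eq_0_iff[OF k] by blast
      have "0 \<le> real_of_int (fst (z g))" "0 \<le> real_of_int (snd (z g))"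
        using zG[OF g] \<open>0 < c * R\<close> by linarith+
      then have zb: "\<bar>real_of_int (fst (z g))\<bar> \<le> R" "\<bar>real_of_int (snd (z g))\<bar> \<le> R"
        using zG[OF g] by auto
      have "qnorm k (z g) = fst (z g) * fst (z g) - int k * snd (z g) * snd (z g)"
        by (simp add: qnorm_def power2_eq_square)
      then have "real_of_int \<bar>qnorm k (z g)\<bar> \<le> (1 + real k) * R * R"
        using abs_norm_form_le[OF zb zb, of k] abs_triangle_ineq4 order.trans
        unfolding of_int_abs of_int_diff by (metis of_int_diff)
      also have "\<dots> \<le> (1 + real k) * (C * real n) * (C * real n)"
        using RC R0 by (intro mult_mono) auto
      also have "\<dots> = ((1 + real k) * C\<^sup>2) * (real n)\<^sup>2" by (simp add: power2_eq_square algebra_simps)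
      also have "\<dots> < real n * (real n)\<^sup>2"
        using n n0 nn0 by (intro mult_strict_right_mono) auto
      also have "\<dots> = real_of_int (int n ^ 3)" by (simp add: power2_eq_square power3_eq_cube)
      finally show "\<bar>qnorm k (z g)\<bar> < int n ^ 3" by (simp only: of_int_less_iff)
    qed
    define good where "good = {(g, h). g \<in> G \<and> h \<in> G \<and>
      coprime (qnorm k (z g)) (qnorm k (z h)) \<and> coprime (fst (z g)) (snd (z g))}"
    have "real n ^ 4 * (1 - 20 / of_int 80) - 8 * real n ^ 3 - R * real n ^ 2 \<le> real (card good)"
    proof -
      have qn: "qnorm k (z g) = (case g of (a, b) \<Rightarrow> 1 + Q * a)\<^sup>2 - int k * (case g of (a, b) \<Rightarrow> Q * b)\<^sup>2"
        and comps: "fst (z g) = (case g of (a, b) \<Rightarrow> 1 + Q * a)" "snd (z g) = (case g of (a, b) \<Rightarrow> Q * b)" for g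
        by (simp_all add: z_def qnorm_def split: prod.split)
      show ?thesis
        unfolding good_def G_def qn comps
      proof (rule sieve_lower_bound)
        show "l dvd Q" if "prime l" "l \<le> 80" for l by (rule Q[OF that])
        show "0 < b \<and> of_int b \<le> R" if "b \<in> {b0..<b0 + int n}" for b by (rule bpos[OF that])
        show "(case g of (a, b) \<Rightarrow> 1 + Q * a)\<^sup>2 - int k * (case g of (a, b) \<Rightarrow> Q * b)\<^sup>2 \<noteq> 0 \<and>
          \<bar>(case g of (a, b) \<Rightarrow> 1 + Q * a)\<^sup>2 - int k * (case g of (a, b) \<Rightarrow> Q * b)\<^sup>2\<bar> < int n ^ 3"
          if "g \<in> {a0..<a0 + int n} \<times> {b0..<b0 + int n}" for g
          using norm[of g] that unfolding G_def qn by blast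
      qed (use n in auto)
    qed
    moreover have "R * real n ^ 2 \<le> C * real n ^ 3"
      using mult_right_mono[OF RC, of "real n ^ 2"] by (simp add: power2_eq_square power3_eq_cube)
    moreover have "(8 + C) * real n ^ 3 \<le> real n ^ 4 / 4"
    proof -
      have "4 * (8 + C) * real n ^ 3 \<le> real n * real n ^ 3"
        using n0 nn0 by (intro mult_right_mono) auto
      also have "\<dots> = real n ^ 4" by (simp flip: power_Suc)
      finally show ?thesis by (simp add: algebra_simps)
    qed
    moreover have "(8 + C) * real n ^ 3 = 8 * real n ^ 3 + C * real n ^ 3"
      by (simp add: algebra_simps)
    ultimately have "real n ^ 4 / 2 \<le> real (card good)" by simp
    moreover have "R ^ 4 \<le> C ^ 4 * real n ^ 4"
      using power_mono[OF RC, of 4] R0 by (simp add: power_mult_distrib)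
    ultimately have bound: "1 / (2 * C ^ 4) * R ^ 4 \<le> real (card good)"
    proof -
      have "R ^ 4 \<le> C ^ 4 * (2 * real (card good))"
        using \<open>real n ^ 4 / 2 \<le> real (card good)\<close> C0
        by (intro order.trans[OF \<open>R ^ 4 \<le> C ^ 4 * real n ^ 4\<close>] mult_left_mono) auto
      then show ?thesis using C0 by (simp add: field_simps)
    qed
    have "card good \<le> card W"
    proof (rule card_inj_on_le)
      have "inj z"
      proof (rule injI)
        fix g h assume "z g = z h"
        then have "Q * fst g = Q * fst h" "Q * snd g = Q * snd h"
          by (simp_all add: z_def split: prod.splits)
        then show "g = h" using \<open>Q > 0\<close> by (simp add: prod_eq_iff)
      qed
      then have "inj (map_prod z z)" by (intro prod.inj_map)
      then show "inj_on (map_prod z z) good" by (rule inj_on_subset) simp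
      show "map_prod z z ` good \<subseteq> W"
      proof (rule image_subsetI)
        fix x assume "x \<in> good"
        then obtain g h where x: "x = (g, h)" "g \<in> G" "h \<in> G"
          "coprime (qnorm k (z g)) (qnorm k (z h))" "coprime (fst (z g)) (snd (z g))"
          unfolding good_def by blast
        show "map_prod z z x \<in> W"
          unfolding W_def using zG[OF x(2)] zG[OF x(3)] x(4,5) by (simp add: x(1))
      qed
      have "W \<subseteq> square \<lfloor>R\<rfloor> \<times> square \<lfloor>R\<rfloor>"
      proof
        fix x assume "x \<in> W"
        then obtain p q where x: "x = (p, q)" and
          b: "\<forall>w\<in>{p, q}. c * R \<le> of_int (fst w) \<and> of_int (fst w) \<le> R \<and> c * R \<le> of_int (snd w) \<and> of_int (snd w) \<le> R"
          unfolding W_def by blast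
        have "0 < c * R" using c R0 by simp
        then have sq: "w \<in> square \<lfloor>R\<rfloor>" if "w \<in> {p, q}" for w
          using bspec[OF b that] by (simp add: mem_square le_floor_iff)
        show "x \<in> square \<lfloor>R\<rfloor> \<times> square \<lfloor>R\<rfloor>"
          unfolding x using sq[of p] sq[of q] by simp
      qed
      then show "finite W" by (rule finite_subset) simp
    qed
    then have "real (card good) \<le> real (card W)" by (rule of_nat_mono)
    with bound have "1 / (2 * C ^ 4) * R ^ 4 \<le> real (card W)" by (rule order.trans)
    then show "1 / (2 * C ^ 4) * R ^ 4 \<le> real (card ?W)" unfolding W_def .
  qed
qed

text \<open>
  For large \<open>M\<close> the quadruples of \<open>many_coprime_norms\<close> inject into the set of quotients; for bounded
  \<open>M\<close> a single element is enough.
\<close>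
lemma card_S_set_ge:
  fixes c :: real
  assumes k: "\<nexists>m::nat. k = m\<^sup>2" "1 < sqrt (real k)"
    and c: "2 * sqrt (real k) + 3 < c * (3 * sqrt (real k) + 2)" "2 < 3 * c" "1 < c * sqrt (real k)" "c < 1"
  obtains \<kappa> :: real where "\<kappa> > 0"
    "\<And>M. M \<ge> 1 \<Longrightarrow> S_set k c M \<noteq> {} \<Longrightarrow> \<kappa> * M\<^sup>2 \<le> real (card (S_set k c M))"
proof -
  have c0: "0 < c" using c by simp
  obtain \<kappa> D :: real where \<kappa>: "\<kappa> > 0" and D: "D > 0" and many: "\<And>R. R \<ge> D \<Longrightarrow> \<kappa> * R ^ 4 \<le> real (card {(p, q).
      (\<forall>z\<in>{p, q}. c * R \<le> of_int (fst z) \<and> of_int (fst z) \<le> R \<and> c * R \<le> of_int (snd z) \<and> of_int (snd z) \<le> R) \<and>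
      coprime (qnorm k p) (qnorm k q) \<and> coprime (fst p) (snd p)})"
    using many_coprime_norms[OF k(1) c0 c(4)] by blast
  show ?thesis
  proof (rule that[of "min \<kappa> (1 / D ^ 4)"])
    show "0 < min \<kappa> (1 / D ^ 4)" using \<kappa> D by simp
    fix M :: real assume M: "M \<ge> 1" and ne: "S_set k c M \<noteq> {}"
    define R where "R = sqrt M"
    have R: "R > 0" "R\<^sup>2 = M" using M by (simp_all add: R_def)
    have R4: "R ^ 4 = M\<^sup>2" unfolding R(2)[symmetric] by (simp flip: power_mult)
    show "min \<kappa> (1 / D ^ 4) * M\<^sup>2 \<le> real (card (S_set k c M))"
    proof (cases "R \<ge> D")
      case True
      define W where "W = {(p, q).
        (\<forall>z\<in>{p, q}. c * R \<le> of_int (fst z) \<and> of_int (fst z) \<le> R \<and> c * R \<le> of_int (snd z) \<and> of_int (snd z) \<le> R) \<and>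
        coprime (qnorm k p) (qnorm k q) \<and> coprime (fst p) (snd p)}"
      have WD: "c * R \<le> of_int (fst z) \<and> of_int (fst z) \<le> R \<and> c * R \<le> of_int (snd z) \<and> of_int (snd z) \<le> R"
        if "(p, q) \<in> W" "z \<in> {p, q}" for p q z
        using that unfolding W_def by blast
      have "card W \<le> card (S_set k c M)"
      proof (rule card_inj_on_le)
        show "inj_on (\<lambda>(p, q). quad k p / quad k q) W"
        proof (rule inj_onI, clarify)
          fix p q p' q' assume pq: "(p, q) \<in> W" and pq': "(p', q') \<in> W" and eq: "quad k p / quad k q = quad k p' / quad k q'"
          show "p = p' \<and> q = q'"
          proof (rule quotient_determines_pair[OF k c(1-3) R(1) _ _ eq])
            show "coprime (qnorm k p) (qnorm k q)" using pq unfolding W_def by blast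
            show "c * R \<le> of_int (fst z) \<and> of_int (fst z) \<le> R \<and> c * R \<le> of_int (snd z) \<and> of_int (snd z) \<le> R"
              if "z \<in> {p, q, p', q'}" for z
              using that WD[OF pq, of z] WD[OF pq', of z] by blast
          qed
        qed
        show "(\<lambda>(p, q). quad k p / quad k q) ` W \<subseteq> S_set k c M"
        proof (rule image_subsetI, clarify)
          fix p q assume pq: "(p, q) \<in> W"
          have "0 < c * R" using c0 R by simp
          then have sh: "z \<in> lattice_shell c (sqrt M)" if "z \<in> {p, q}" for z
            using WD[OF pq that] by (simp add: lattice_shell_def flip: R_def)
          have "gcd (qnorm k p) (qnorm k q) = 1" "gcd (fst p) (snd p) = 1"
            using pq unfolding W_def by (simp_all add: coprime_iff_gcd_eq_1)
          then show "quad k p / quad k q \<in> S_set k c M"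
            unfolding S_set_eq using sh[of p] sh[of q] by (intro CollectI exI[of _ p] exI[of _ q]) simp
        qed
      qed (rule finite_S_set)
      then have "real (card W) \<le> real (card (S_set k c M))" by (rule of_nat_mono)
      moreover have "\<kappa> * R ^ 4 \<le> real (card W)" using many[OF True] unfolding W_def .
      moreover have "min \<kappa> (1 / D ^ 4) * M\<^sup>2 \<le> \<kappa> * M\<^sup>2" by (rule mult_right_mono) auto
      ultimately show ?thesis by (simp add: R4)
    next
      case False
      have "R ^ 4 \<le> D ^ 4" using False R by (intro power_mono) auto
      have "min \<kappa> (1 / D ^ 4) * M\<^sup>2 \<le> 1 / D ^ 4 * M\<^sup>2" by (rule mult_right_mono) auto
      also have "\<dots> \<le> 1" using \<open>R ^ 4 \<le> D ^ 4\<close> D by (simp add: R4)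
      also have "1 \<le> card (S_set k c M)"
        using ne finite_S_set by (simp add: Suc_le_eq card_gt_0_iff)
      then have "1 \<le> real (card (S_set k c M))" by simp
      finally show ?thesis .
    qed
  qed
qed

section \<open>The sum of the energies\<close>

text \<open>
  Each of the \<open>|X|\<close> summands is of order \<open>N\<^sup>3 / M\<close>, and \<open>|X| / M\<close> is of order \<open>\<surd>|X|\<close>.
\<close>
lemma energy_sum_bounds:
  fixes c :: real
  assumes k: "\<nexists>m::nat. k = m\<^sup>2" "1 < sqrt (real k)"
    and c: "2 * sqrt (real k) + 3 < c * (3 * sqrt (real k) + 2)" "2 < 3 * c" "1 < c * sqrt (real k)" "c < 1"
  obtains C1 C2 :: real where "C1 > 0" "C2 > 0"
    "\<And>N M. 1 \<le> M \<Longrightarrow> M \<le> N \<Longrightarrow>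
      card (S_set k c M) \<le> (card (A_set k N))\<^sup>2 \<and>
      C1 * real (card (A_set k N)) ^ 3 * sqrt (real (card (S_set k c M)))
        \<le> real (\<Sum>x\<in>S_set k c M. additive_energy (A_set k N) (dilate x (A_set k N))) \<and>
      real (\<Sum>x\<in>S_set k c M. additive_energy (A_set k N) (dilate x (A_set k N)))
        \<le> C2 * real (card (A_set k N)) ^ 3 * sqrt (real (card (S_set k c M)))"
proof -
  have cpos: "0 < c" using c(2) by simp
  obtain \<kappa> where \<kappa>: "\<kappa> > 0" and
    many: "\<And>M. M \<ge> 1 \<Longrightarrow> S_set k c M \<noteq> {} \<Longrightarrow> \<kappa> * M\<^sup>2 \<le> real (card (S_set k c M))"
    using card_S_set_ge[OF k c] by blast
  define \<delta> where "\<delta> = real k * c\<^sup>2 - 1"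
  have "1 < (c * sqrt (real k))\<^sup>2" using c(3) by (simp add: one_less_power)
  then have \<delta>: "\<delta> > 0" by (simp add: \<delta>_def power_mult_distrib mult.commute)
  define K1 where "K1 = 1 / (256 * (1 + real k)\<^sup>2)"
  define K2 where "K2 = 81 * (20 * (1 + real k) / \<delta> + 1)\<^sup>2"
  have K1: "K1 > 0" by (simp add: K1_def add_pos_nonneg)
  have "0 < 20 * (1 + real k) / \<delta> + 1" using \<delta> by (simp add: add_nonneg_pos)
  then have K2: "K2 > 0" by (simp add: K2_def)
  define C1 where "C1 = K1 * sqrt \<kappa> / 729"
  define C2 where "C2 = 9 * K2"
  have main: "card (S_set k c M) \<le> (card (A_set k N))\<^sup>2 \<and>
      C1 * real (card (A_set k N)) ^ 3 * sqrt (real (card (S_set k c M)))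
        \<le> real (\<Sum>x\<in>S_set k c M. additive_energy (A_set k N) (dilate x (A_set k N))) \<and>
      real (\<Sum>x\<in>S_set k c M. additive_energy (A_set k N) (dilate x (A_set k N)))
        \<le> C2 * real (card (A_set k N)) ^ 3 * sqrt (real (card (S_set k c M)))"
    if M: "1 \<le> M" and N: "M \<le> N" for N M :: real
  proof -
    let ?A = "A_set k N" and ?X = "S_set k c M"
    define E where "E x = real (additive_energy ?A (dilate x ?A))" for x
    define X where "X = real (card ?X)"
    define a where "a = real (card ?A)"
    have N1: "1 \<le> N" using M N by linarith
    have a: "N \<le> a" "a \<le> 9 * N" unfolding a_def using card_A_set_bounds[OF k(1) N1] by auto
    have sum: "real (\<Sum>x\<in>?X. additive_energy ?A (dilate x ?A)) = (\<Sum>x\<in>?X. E x)"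
      by (simp add: E_def)
    have energy: "K1 * (N ^ 3 / M) \<le> E x" "E x \<le> K2 * (N ^ 3 / M)" if x: "x \<in> ?X" for x
    proof -
      obtain p q where xpq: "x = quad k p / quad k q"
        and pq: "p \<in> lattice_shell c (sqrt M)" "q \<in> lattice_shell c (sqrt M)"
        and g: "gcd (qnorm k p) (qnorm k q) \<le> 5"
        using x unfolding S_set_eq by blast
      have "0 < c * sqrt M" using cpos M by simp
      then have nz: "p \<noteq> 0" "q \<noteq> 0" using pq by (auto simp: lattice_shell_def)
      have norm: "\<delta> * M \<le> \<bar>real_of_int (qnorm k q)\<bar>"
        using qnorm_shell_ge[OF cpos _ pq(2), of k] M by (simp add: \<delta>_def)
      have b: "\<bar>real_of_int (fst p)\<bar> \<le> sqrt M" "\<bar>real_of_int (snd p)\<bar> \<le> sqrt M"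
        "\<bar>real_of_int (fst q)\<bar> \<le> sqrt M" "\<bar>real_of_int (snd q)\<bar> \<le> sqrt M"
        using pq by (auto simp: lattice_shell_def)
      show "K1 * (N ^ 3 / M) \<le> E x"
        using energy_lower_bound[OF k(1) M N nz b] by (simp add: E_def xpq K1_def mult.commute)
      show "E x \<le> K2 * (N ^ 3 / M)"
        using energy_upper_bound[OF k(1) M N \<delta> nz(1) b(3,4) norm g] by (simp add: E_def xpq K2_def)
    qed
    have X4: "X \<le> (2 * of_int \<lfloor>sqrt M\<rfloor> + 1) ^ 4"
      unfolding X_def using M by (intro card_S_set_le) simp
    have fl: "0 \<le> \<lfloor>sqrt M\<rfloor>" "\<lfloor>sqrt M\<rfloor> \<le> \<lfloor>sqrt N\<rfloor>" using M N by (simp_all add: floor_mono)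
    have "X \<le> a\<^sup>2"
    proof -
      have "(2 * of_int \<lfloor>sqrt M\<rfloor> + 1) ^ 4 \<le> (2 * real_of_int \<lfloor>sqrt N\<rfloor> + 1) ^ 4"
        using fl by (intro power_mono) auto
      also have "\<dots> = a\<^sup>2" using card_A_set[OF k(1), of N] N1 by (simp add: a_def flip: power_mult)
      finally show ?thesis using X4 by linarith
    qed
    then have "card ?X \<le> (card ?A)\<^sup>2"
      unfolding X_def a_def by (simp flip: of_nat_power)
    moreover have "X \<le> 9 * M * sqrt X"
    proof -
      have "1 \<le> sqrt M" using M by simp
      then have "(2 * of_int \<lfloor>sqrt M\<rfloor> + 1) ^ 4 \<le> (3 * sqrt M) ^ 4"
        using fl(1) by (intro power_mono) (linarith, simp)
      also have "\<dots> = (9 * M)\<^sup>2"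
      proof -
        have "(3 * sqrt M) ^ 4 = ((3 * sqrt M)\<^sup>2)\<^sup>2" by (simp flip: power_mult)
        also have "(3 * sqrt M)\<^sup>2 = 9 * M" using M by (simp add: power_mult_distrib)
        finally show ?thesis .
      qed
      finally have "X \<le> (9 * M)\<^sup>2" using X4 by linarith
      then have "sqrt X \<le> 9 * M" using M by (intro real_le_lsqrt) (auto simp: X_def)
      then have "sqrt X * sqrt X \<le> 9 * M * sqrt X" by (rule mult_right_mono) (simp add: X_def)
      then show ?thesis by (simp add: X_def)
    qed
    moreover have "sqrt \<kappa> * M * sqrt X \<le> X"
    proof (cases "?X = {}")
      case False
      have "sqrt (\<kappa> * M\<^sup>2) \<le> sqrt X" unfolding X_def using many[OF M False] by (rule real_sqrt_le_mono)
      then have "sqrt \<kappa> * M \<le> sqrt X" using M by (simp add: real_sqrt_mult)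
      then have "sqrt \<kappa> * M * sqrt X \<le> sqrt X * sqrt X" by (rule mult_right_mono) (simp add: X_def)
      then show ?thesis by (simp add: X_def)
    qed (simp add: X_def)
    moreover have "C1 * a ^ 3 * sqrt X \<le> (\<Sum>x\<in>?X. E x)" if "sqrt \<kappa> * M * sqrt X \<le> X"
    proof -
      have "C1 * a ^ 3 * sqrt X \<le> C1 * (9 * N) ^ 3 * sqrt X"
        using a N1 K1 \<kappa> by (intro mult_right_mono mult_left_mono power_mono) (auto simp: C1_def X_def)
      also have "\<dots> = K1 * (N ^ 3 / M) * (sqrt \<kappa> * M * sqrt X)"
        using M by (simp add: C1_def power_mult_distrib)
      also have "\<dots> \<le> K1 * (N ^ 3 / M) * X"
        using that K1 M N1 by (intro mult_left_mono) auto
      also have "\<dots> = (\<Sum>x\<in>?X. K1 * (N ^ 3 / M))" by (simp add: X_def)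
      also have "\<dots> \<le> (\<Sum>x\<in>?X. E x)" by (intro sum_mono energy)
      finally show ?thesis .
    qed
    moreover have "(\<Sum>x\<in>?X. E x) \<le> C2 * a ^ 3 * sqrt X" if "X \<le> 9 * M * sqrt X"
    proof -
      have "(\<Sum>x\<in>?X. E x) \<le> (\<Sum>x\<in>?X. K2 * (N ^ 3 / M))" by (intro sum_mono energy)
      also have "\<dots> = K2 * (N ^ 3 / M) * X" by (simp add: X_def)
      also have "\<dots> \<le> K2 * (N ^ 3 / M) * (9 * M * sqrt X)"
        using that K2 M N1 by (intro mult_left_mono) auto
      also have "\<dots> = C2 * N ^ 3 * sqrt X" using M by (simp add: C2_def)
      also have "\<dots> \<le> C2 * a ^ 3 * sqrt X"
        using a N1 K2 by (intro mult_right_mono mult_left_mono power_mono) (auto simp: C2_def X_def)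
      finally show ?thesis .
    qed
    ultimately show ?thesis
      unfolding sum unfolding X_def a_def by blast
  qed
  have "C1 > 0" "C2 > 0" using K1 K2 \<kappa> by (simp_all add: C1_def C2_def)
  then show ?thesis using main by (rule that)
qed

theorem lemma1p8:
  fixes k :: nat
  assumes "k > 0" and "\<nexists>m::nat. k = m\<^sup>2"
  shows "\<exists>c0::real. 0 < c0 \<and> c0 < 1 \<and>
    (\<forall>c::real. c0 < c \<and> c < 1 \<longrightarrow>
      (\<exists>(C1::real) (C2::real) (N0::real). C1 > 0 \<and> C2 > 0 \<and>
        (\<forall>(N::real) (M::real). N \<ge> N0 \<and> 1 \<le> M \<and> M \<le> N \<longrightarrow>
          (let A = A_set k N; X = S_set k c M in
             card X \<le> (card A)\<^sup>2 \<and>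
             C1 * real (card A) ^ 3 * sqrt (real (card X))
               \<le> real (\<Sum>x\<in>X. additive_energy A (dilate x A)) \<and>
             real (\<Sum>x\<in>X. additive_energy A (dilate x A))
               \<le> C2 * real (card A) ^ 3 * sqrt (real (card X))))))"
proof -
  note k = assms(2)
  define s where "s = sqrt (real k)"
  have "k \<noteq> 1" using k by (metis one_power2)
  then have s: "1 < s" using assms(1) by (simp add: s_def)
  \<comment> \<open>For \<open>c s > 1\<close>, the inequality \<open>c > c0\<close> says exactly \<open>(s - c) / (c s - 1) < 3/2\<close>: the conjugates of the
    elements with coordinates in the range \<open>[c R, R]\<close> then agree up to a factor below \<open>3/2\<close>.\<close>
  define c0 where "c0 = (2 * s + 3) / (3 * s + 2)"
  have c0: "0 < c0" "c0 < 1" using s by (simp_all add: c0_def)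
  show ?thesis
  proof (rule exI[of _ c0], intro conjI c0 allI impI, elim conjE)
    fix c :: real assume c: "c0 < c" "c < 1"
    have c1: "2 * s + 3 < c * (3 * s + 2)"
      using c(1) s by (simp add: c0_def pos_divide_less_eq)
    have "2 / 3 \<le> c0" using s by (simp add: c0_def field_simps)
    then have c2: "2 < 3 * c" using c by linarith
    have "1 / s \<le> c0"
    proof -
      have "1 * 1 \<le> s * s" using s by (intro mult_mono) auto
      then show ?thesis using s by (simp add: c0_def field_simps)
    qed
    then have "1 / s < c" using c by linarith
    then have c3: "1 < c * s" using s by (simp add: field_simps)
    obtain C1 C2 :: real where C: "C1 > 0" "C2 > 0" and bounds: "\<And>N M. 1 \<le> M \<Longrightarrow> M \<le> N \<Longrightarrow>
      card (S_set k c M) \<le> (card (A_set k N))\<^sup>2 \<and>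
      C1 * real (card (A_set k N)) ^ 3 * sqrt (real (card (S_set k c M)))
        \<le> real (\<Sum>x\<in>S_set k c M. additive_energy (A_set k N) (dilate x (A_set k N))) \<and>
      real (\<Sum>x\<in>S_set k c M. additive_energy (A_set k N) (dilate x (A_set k N)))
        \<le> C2 * real (card (A_set k N)) ^ 3 * sqrt (real (card (S_set k c M)))"
      using energy_sum_bounds[OF k s[unfolded s_def] c1[unfolded s_def] c2 c3[unfolded s_def] c(2)] by blast
    show "\<exists>(C1::real) (C2::real) (N0::real). C1 > 0 \<and> C2 > 0 \<and>
        (\<forall>(N::real) (M::real). N \<ge> N0 \<and> 1 \<le> M \<and> M \<le> N \<longrightarrow>
          (let A = A_set k N; X = S_set k c M in
             card X \<le> (card A)\<^sup>2 \<and>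
             C1 * real (card A) ^ 3 * sqrt (real (card X))
               \<le> real (\<Sum>x\<in>X. additive_energy A (dilate x A)) \<and>
             real (\<Sum>x\<in>X. additive_energy A (dilate x A))
               \<le> C2 * real (card A) ^ 3 * sqrt (real (card X))))"
      unfolding Let_def
    proof (rule exI[of _ C1], rule exI[of _ C2], rule exI[of _ 1],
        rule conjI[OF C(1) conjI[OF C(2)]], intro allI impI, elim conjE)
      fix N M :: real assume MN: "1 \<le> M" "M \<le> N"
      show "card (S_set k c M) \<le> (card (A_set k N))\<^sup>2 \<and>
        C1 * real (card (A_set k N)) ^ 3 * sqrt (real (card (S_set k c M)))
          \<le> real (\<Sum>x\<in>S_set k c M. additive_energy (A_set k N) (dilate x (A_set k N))) \<and>
        real (\<Sum>x\<in>S_set k c M. additive_energy (A_set k N) (dilate x (A_set k N)))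
          \<le> C2 * real (card (A_set k N)) ^ 3 * sqrt (real (card (S_set k c M)))"
        by (rule bounds[OF MN])
    qed
  qed
qed

end
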